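(* Let $\theta=(\theta_1,\theta_2,\theta_3,\theta_4)\in\mathbb{C}^4$ be arbitrary, and let $\mathcal{O}\subset\mathcal{S}(\theta)$ be a (possibly infinite) $G(2)$-orbit consisting of $d\ge 7$ points. Then $\mathcal{O}$ is finite if and only if $$\mathcal{O}\subset\mathcal{S}(\theta)\cap(2\cos\pi\mathbb{Q})^3.$$ If this is the case, then $\theta_1,\theta_2,\theta_3,\theta_4$ are real cyclotomic integers such that $$-8<\theta_1,\theta_2,\theta_3<8,\qquad -28<\theta_4<28.$$
   Context: For $\theta=(\theta_1,\theta_2,\theta_3,\theta_4)\in\mathbb{C}^4$, $\mathcal{S}(\theta)$ is the complex affine cubic surface $$\mathcal{S}(\theta)=\{x=(x_1,x_2,x_3)\in\mathbb{C}^3: x_1x_2x_3+x_1^2+x_2^2+x_3^2-\theta_1x_1-\theta_2x_2-\theta_3x_3+\theta_4=0\}.$$ For $i=1,2,3$, the defining equation is quadratic in $x_i$, and the involution $\sigma_i:\mathcal{S}(\theta)\to\mathcal{S}(\theta)$ exchanges the two roots in $x_i$ while fixing the other two coordinates; explicitly, with $\{i,j,k\}=\{1,2,3\}$, $\sigma_i$ replaces $x_i$ by $\theta_i-x_i-x_jx_k$ and fixes $x_j,x_k$. Let $G=\langle\sigma_1,\sigma_2,\sigma_3\rangle$ (the only relations are $\sigma_1^2=\sigma_2^2=\sigma_3^2=1$), and let $G(2)\subset G$ be the index-two subgroup of all words of even length in $\sigma_1,\sigma_2,\sigma_3$. The degree of an orbit is its number of points. Here $2\cos\pi\mathbb{Q}=\{2\cos(\pi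 r): r\in\mathbb{Q}\}$, and a real cyclotomic integer is a real number lying in the ring of integers of some cyclotomic field. *)

theory Defs
  imports Complex_Main "HOL-Algebra.Group_Action" "HOL-Algebra.Generated_Fields"
    "HOL-Algebra.Algebraic_Closure_Type"
begin

type_synonym params = "complex \<times> complex \<times> complex \<times> complex"
type_synonym point = "complex \<times> complex \<times> complex"

fun cubic_surface :: "params \<Rightarrow> point set" where
  "cubic_surface (\<theta>1, \<theta>2, \<theta>3, \<theta>4) =
     {(x1, x2, x3).
        x1 * x2 * x3 + x1 ^ 2 + x2 ^ 2 + x3 ^ 2
          - \<theta>1 * x1 - \<theta>2 * x2 - \<theta>3 * x3 + \<theta>4 = 0}"

text \<open>
  The involutions are maps from the surface to itself, so they are extensional: outside the
  surface they are \<^const>\<open>undefined\<close>, as the group \<^const>\<open>BijGroup\<close> of bijections of a set requires.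
\<close>

fun flip1 :: "params \<Rightarrow> point \<Rightarrow> point" where
  "flip1 (\<theta>1, \<theta>2, \<theta>3, \<theta>4) =
     (\<lambda>(x1, x2, x3) \<in> cubic_surface (\<theta>1, \<theta>2, \<theta>3, \<theta>4). (\<theta>1 - x1 - x2 * x3, x2, x3))"

fun flip2 :: "params \<Rightarrow> point \<Rightarrow> point" where
  "flip2 (\<theta>1, \<theta>2, \<theta>3, \<theta>4) =
     (\<lambda>(x1, x2, x3) \<in> cubic_surface (\<theta>1, \<theta>2, \<theta>3, \<theta>4). (x1, \<theta>2 - x2 - x1 * x3, x3))"

fun flip3 :: "params \<Rightarrow> point \<Rightarrow> point" where
  "flip3 (\<theta>1, \<theta>2, \<theta>3, \<theta>4) =
     (\<lambda>(x1, x2, x3) \<in> cubic_surface (\<theta>1, \<theta>2, \<theta>3, \<theta>4). (x1, x2, \<theta>3 - x3 - x1 * x2))"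

definition flips :: "params \<Rightarrow> (point \<Rightarrow> point) set" where
  "flips \<theta> = {flip1 \<theta>, flip2 \<theta>, flip3 \<theta>}"

definition flip_group :: "params \<Rightarrow> (point \<Rightarrow> point) monoid" where
  "flip_group \<theta> =
     (BijGroup (cubic_surface \<theta>))
       \<lparr>carrier := generate (BijGroup (cubic_surface \<theta>)) (flips \<theta>)\<rparr>"

definition flip_group2 :: "params \<Rightarrow> (point \<Rightarrow> point) monoid" where
  "flip_group2 \<theta> =
     (flip_group \<theta>)
       \<lparr>carrier := {foldr (monoid.mult (flip_group \<theta>)) ws \<one>\<^bsub>flip_group \<theta>\<^esub> | ws.
                      set ws \<subseteq> flips \<theta> \<and> even (length ws)}\<rparr>"

definition two_cos_pi_rat :: "complex set" where
  "two_cos_pi_rat = {of_real (2 * cos (pi * of_rat r)) | r. True}"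

definition cyclotomic_field :: "nat \<Rightarrow> complex set" where
  "cyclotomic_field n = generate_field ring_of_type_algebra {cis (2 * pi / real n)}"

definition real_cyclotomic_integer :: "complex \<Rightarrow> bool" where
  "real_cyclotomic_integer z \<longleftrightarrow>
     z \<in> \<real> \<and> (\<exists>n\<ge>1. z \<in> cyclotomic_field n \<and> algebraic_int z)"

lemma flip_closed:
  assumes "f \<in> flips \<theta>" "x \<in> cubic_surface \<theta>"
  shows "f x \<in> cubic_surface \<theta>" and flip_flip: "f (f x) = x"
proof -
  obtain a b c d where \<theta>: "\<theta> = (a, b, c, d)" by (cases \<theta>)
  obtain x1 x2 x3 where x: "x = (x1, x2, x3)" by (cases x)
  show *: "f x \<in> cubic_surface \<theta>"
    using assms by (auto simp: \<theta> x flips_def algebra_simps power2_eq_square)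
  show "f (f x) = x"
    using assms * by (auto simp: \<theta> x flips_def restrict_def split: if_splits)
qed

lemma flips_subset_Bij: "flips \<theta> \<subseteq> Bij (cubic_surface \<theta>)"
proof
  fix f assume f: "f \<in> flips \<theta>"
  have "f \<in> extensional (cubic_surface \<theta>)"
    using f by (cases \<theta>) (auto simp: flips_def)
  moreover have "bij_betw f (cubic_surface \<theta>) (cubic_surface \<theta>)"
    using flip_closed[OF f] flip_flip[OF f]
    by (intro bij_betw_byWitness[where f' = f]) blast+
  ultimately show "f \<in> Bij (cubic_surface \<theta>)"
    by (simp add: Bij_def)
qed

lemma group_flip_group: "group (flip_group \<theta>)"
  unfolding flip_group_def
  using group.generate_is_subgroup[OF group_BijGroup, of "flips \<theta>" "cubic_surface \<theta>"]
    flips_subset_Bij[of \<theta>] group.subgroup_imp_group[OF group_BijGroup]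
  by (simp add: BijGroup_def)

lemma flips_subset_flip_group: "flips \<theta> \<subseteq> carrier (flip_group \<theta>)"
  by (auto simp: flip_group_def intro: generate.incl)

lemma flip_mult_self:
  assumes "f \<in> flips \<theta>"
  shows "f \<otimes>\<^bsub>flip_group \<theta>\<^esub> f = \<one>\<^bsub>flip_group \<theta>\<^esub>"
  using assms flips_subset_Bij[of \<theta>]
  by (auto simp: flip_group_def BijGroup_def compose_def restrict_def flip_flip subset_iff)

lemma (in group) foldr_mult_closed:
  "set ws \<subseteq> carrier G \<Longrightarrow> foldr (monoid.mult G) ws \<one> \<in> carrier G"
  by (induction ws) auto

lemma (in group) foldr_mult_append:
  "set us \<subseteq> carrier G \<Longrightarrow> set ws \<subseteq> carrier G \<Longrightarrow>
     foldr (monoid.mult G) (us @ ws) \<one> = foldr (monoid.mult G) us \<one> \<otimes> foldr (monoid.mult G) ws \<one>"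
proof (induction us)
  case (Cons u us)
  then show ?case
    using foldr_mult_closed[of us] foldr_mult_closed[of ws]
    by (simp add: m_assoc del: foldr_append)
qed (use foldr_mult_closed[of ws] in simp)

lemma (in group) inv_foldr_mult:
  assumes "set ws \<subseteq> carrier G" "\<And>w. w \<in> set ws \<Longrightarrow> w \<otimes> w = \<one>"
  shows "inv (foldr (monoid.mult G) ws \<one>) = foldr (monoid.mult G) (rev ws) \<one>"
  using assms
proof (induction ws)
  case (Cons w ws)
  have "inv w = w"
    using Cons.prems by (intro inv_equality) auto
  then show ?case
    using Cons foldr_mult_closed[of ws] foldr_mult_append[of "rev ws" "[w]"]
    by (simp add: inv_mult_group del: foldr_append)
qed simp

lemma subgroup_flip_group2: "subgroup (carrier (flip_group2 \<theta>)) (flip_group \<theta>)"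
proof -
  interpret G: group "flip_group \<theta>" by (rule group_flip_group)
  let ?w = "\<lambda>ws. foldr (monoid.mult (flip_group \<theta>)) ws \<one>\<^bsub>flip_group \<theta>\<^esub>"
  have carr: "carrier (flip_group2 \<theta>) = {?w ws | ws. set ws \<subseteq> flips \<theta> \<and> even (length ws)}"
    by (simp add: flip_group2_def)
  show ?thesis
  proof (rule G.subgroupI)
    show "carrier (flip_group2 \<theta>) \<subseteq> carrier (flip_group \<theta>)"
      unfolding carr using G.foldr_mult_closed flips_subset_flip_group by blast
    have "?w [] \<in> carrier (flip_group2 \<theta>)"
      unfolding carr by (intro CollectI exI[of _ "[]"]) simp
    then show "carrier (flip_group2 \<theta>) \<noteq> {}" by blast
  next
    fix g assume "g \<in> carrier (flip_group2 \<theta>)"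
    then obtain ws where ws: "g = ?w ws" "set ws \<subseteq> flips \<theta>" "even (length ws)"
      unfolding carr by blast
    have "inv\<^bsub>flip_group \<theta>\<^esub> g = ?w (rev ws)"
      unfolding ws(1) using ws(2) flips_subset_flip_group flip_mult_self
      by (intro G.inv_foldr_mult) blast+
    then show "inv\<^bsub>flip_group \<theta>\<^esub> g \<in> carrier (flip_group2 \<theta>)"
      unfolding carr using ws by (intro CollectI exI[of _ "rev ws"]) simp
  next
    fix g h assume "g \<in> carrier (flip_group2 \<theta>)" "h \<in> carrier (flip_group2 \<theta>)"
    then obtain us ws where us: "g = ?w us" "set us \<subseteq> flips \<theta>" "even (length us)"
      and ws: "h = ?w ws" "set ws \<subseteq> flips \<theta>" "even (length ws)"
      unfolding carr by blast
    have "g \<otimes>\<^bsub>flip_group \<theta>\<^esub> h = ?w (us @ ws)"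
      unfolding us(1) ws(1) using us(2) ws(2) flips_subset_flip_group
      by (intro G.foldr_mult_append[symmetric]) blast+
    then show "g \<otimes>\<^bsub>flip_group \<theta>\<^esub> h \<in> carrier (flip_group2 \<theta>)"
      unfolding carr using us ws by (intro CollectI exI[of _ "us @ ws"]) simp
  qed
qed

lemma group_action_flip_group2:
  "group_action (flip_group2 \<theta>) (cubic_surface \<theta>) (\<lambda>g. g)"
proof -
  let ?B = "BijGroup (cubic_surface \<theta>)"
  have G2: "flip_group2 \<theta> = (flip_group \<theta>)\<lparr>carrier := carrier (flip_group2 \<theta>)\<rparr>"
    by (simp add: flip_group2_def)
  have "group (flip_group2 \<theta>)"
    by (subst G2) (rule group.subgroup_imp_group[OF group_flip_group subgroup_flip_group2])
  moreover have "carrier (flip_group \<theta>) \<subseteq> carrier ?B"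
    unfolding flip_group_def using group.generate_incl[OF group_BijGroup] flips_subset_Bij[of \<theta>]
    by (simp add: BijGroup_def)
  then have "carrier (flip_group2 \<theta>) \<subseteq> carrier ?B"
    using subgroup.subset[OF subgroup_flip_group2] by blast
  then have "(\<lambda>g. g) \<in> hom (flip_group2 \<theta>) ?B"
    by (auto simp: hom_def flip_group2_def flip_group_def)
  ultimately show ?thesis
    by (simp add: group_action_def group_hom_def group_hom_axioms_def group_BijGroup)
qed

end

theory Submission
  imports Defs "Jordan_Normal_Form.Char_Poly"
begin

text \<open>
  If the third coordinate \<open>z = l + 1/l\<close> of a point \<open>p\<close> of a finite orbit is not in
  \<open>2 cos \<pi>\<rat>\<close>, then \<open>s1 \<circ> s2\<close> acts on the level set of \<open>z\<close> by an affine map of infinite order with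
  a single periodic point, so \<open>p\<close> is fixed by \<open>s1\<close> and \<open>s2\<close>, the orbit is invariant under all
  three flips, and the level conic splits into two lines of the surface that meet in \<open>p\<close>.
  Let \<open>h\<close> be the quotient of the equation of one of these lines by \<open>x3 - z\<close>.
  It satisfies \<open>h/l \<mapsto> - x1 - l/h\<close> under \<open>s2 \<circ> s3\<close> and \<open>h \<mapsto> - x2 - 1/h\<close> under \<open>s1 \<circ> s3\<close>, so its
  product over a cycle is computed by a linear recurrence in terms of the multiplier of the cycle,
  which is a root of unity unless the cycle is itself a bad fixed point.
  Computing the product of \<open>h\<close> over the orbit along both families of cycles gives, modulo
  torsion, \<open>l ^ (d - 2)\<close> as a product of multipliers of the other bad points with exponents in
  \<open>{-1, 0, 1}\<close>. There are at most \<open>d - 2\<close> bad points, so this system of multiplicative relations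
  is strictly diagonally dominant and all multipliers are roots of unity, a contradiction.

  Conversely, if all coordinates are in \<open>2 cos \<pi>\<rat>\<close>, they lie in some \<open>\<int>[\<zeta>]\<close> with a root of
  unity \<open>\<zeta>\<close>, and by Kronecker's argument \<open>\<int>[\<zeta>]\<close> contains only finitely many elements all of whose
  conjugates are in \<open>[-2, 2]\<close>. The bounds follow from \<open>\<theta>1 = x1 + x1' + x2 x3\<close> and
  \<open>\<theta>4 = x1 x1' + x2 x2' + x3 x3' + 2 x1 x2 x3\<close>, where equality forces all points into
  \<open>{2, -2}\<^sup>3\<close> and leaves at most four of them.
\<close>

section \<open>Roots of unity and linear recurrences\<close>

definition root_of_unity :: "complex \<Rightarrow> bool" where
  "root_of_unity w \<longleftrightarrow> (\<exists>n>0. w ^ n = 1)"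

lemma root_of_unityI: "w ^ n = 1 \<Longrightarrow> n > 0 \<Longrightarrow> root_of_unity w"
  by (auto simp: root_of_unity_def)

lemma root_of_unity_1 [simp]: "root_of_unity 1"
  by (rule root_of_unityI[of _ 1]) auto

lemma root_of_unity_nonzero: "root_of_unity w \<Longrightarrow> w \<noteq> 0"
  by (auto simp: root_of_unity_def power_0_left)

lemma root_of_unity_mult:
  assumes "root_of_unity v" "root_of_unity w"
  shows "root_of_unity (v * w)"
proof -
  obtain i j where "i > 0" "v ^ i = 1" "j > 0" "w ^ j = 1"
    using assms by (auto simp: root_of_unity_def)
  have "(v * w) ^ (i * j) = (v ^ i) ^ j * (w ^ j) ^ i"
    by (metis mult.commute power_mult power_mult_distrib)
  then show ?thesis
    using \<open>i > 0\<close> \<open>v ^ i = 1\<close> \<open>j > 0\<close> \<open>w ^ j = 1\<close> by (intro root_of_unityI[of _ "i * j"]) auto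
qed

lemma root_of_unity_inverse: "root_of_unity w \<Longrightarrow> root_of_unity (inverse w)"
  by (auto simp: root_of_unity_def power_inverse)

lemma root_of_unity_divide: "root_of_unity v \<Longrightarrow> root_of_unity w \<Longrightarrow> root_of_unity (v / w)"
  by (simp add: divide_inverse root_of_unity_mult root_of_unity_inverse)

lemma root_of_unity_power: "root_of_unity w \<Longrightarrow> root_of_unity (w ^ n)"
  by (induction n) (auto intro: root_of_unity_mult)

lemma root_of_unity_powi: "root_of_unity w \<Longrightarrow> root_of_unity (w powi i)"
  by (auto simp: power_int_def root_of_unity_power root_of_unity_inverse)

lemma root_of_unity_power_iff: "n > 0 \<Longrightarrow> root_of_unity (w ^ n) \<longleftrightarrow> root_of_unity w"
  by (metis nat_0_less_mult_iff power_mult root_of_unity_def root_of_unity_power)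

lemma root_of_unity_uminus_1 [simp]: "root_of_unity (- 1)"
  by (rule root_of_unityI[of _ 2]) auto

lemma root_of_unity_uminus_iff [simp]: "root_of_unity (- w) \<longleftrightarrow> root_of_unity w"
  using root_of_unity_mult[of "- 1" w] root_of_unity_mult[of "- 1" "- w"] by auto

lemma root_of_unity_minus_one_power_mult_iff [simp]:
  "root_of_unity ((- 1) ^ n * w) \<longleftrightarrow> root_of_unity w"
  by (cases "even n") auto

lemma prod_powi: "(\<Prod>i\<in>A. f i powi n) = (prod f A :: complex) powi n"
  by (induction A rule: infinite_finite_induct) (auto simp: power_int_mult_distrib)

lemma root_of_unity_prod: "(\<And>i. i \<in> A \<Longrightarrow> root_of_unity (f i)) \<Longrightarrow> root_of_unity (prod f A)"
  by (induction A rule: infinite_finite_induct) (auto intro: root_of_unity_mult)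

lemma root_of_unity_cis_of_rat: "root_of_unity (cis (pi * of_rat r))"
proof -
  obtain a b where ab: "r = of_int a / of_int b" "b > (0::int)"
    by (metis Fract_of_int_quotient Rat_cases)
  have "cis (pi * of_rat r) ^ (2 * nat b) = cis (2 * pi * of_int a)"
    using ab by (simp add: DeMoivre of_rat_divide algebra_simps)
  also have "\<dots> = 1"
    by (metis cis_multiple_2pi Ints_of_int)
  finally show ?thesis
    using ab by (intro root_of_unityI) auto
qed

lemma root_of_unityE:
  assumes "root_of_unity w"
  obtains r where "w = cis (pi * of_rat r)"
proof -
  obtain n where n: "n > 0" "w ^ n = 1"
    using assms by (auto simp: root_of_unity_def)
  then obtain k where "w = cis (2 * pi * real k / real n)"
    using bij_betw_roots_unity[OF n(1)] by (auto simp: bij_betw_def)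
  then have "w = cis (pi * of_rat (2 * of_nat k / of_nat n))"
    by (simp add: of_rat_divide of_rat_mult algebra_simps)
  then show ?thesis using that by blast
qed

lemma cis_add_inverse: "cis t + inverse (cis t) = of_real (2 * cos t)"
  by (simp add: complex_eq_iff)

lemma two_cos_pi_rat_iff:
  "w \<in> two_cos_pi_rat \<longleftrightarrow> (\<exists>u. root_of_unity u \<and> w = u + inverse u)"
  unfolding two_cos_pi_rat_def mem_Collect_eq cis_add_inverse[symmetric]
  by (metis root_of_unity_cis_of_rat root_of_unityE)

lemma two_cos_pi_rat_uminus_iff: "- w \<in> two_cos_pi_rat \<longleftrightarrow> w \<in> two_cos_pi_rat"
proof -
  have "- w \<in> two_cos_pi_rat" if "w \<in> two_cos_pi_rat" for w
    using that unfolding two_cos_pi_rat_iff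
    by (metis root_of_unity_uminus_iff inverse_minus_eq minus_add_distrib)
  from this[of w] this[of "- w"] show ?thesis by auto
qed

lemma two_in_two_cos_pi_rat: "2 \<in> two_cos_pi_rat"
  unfolding two_cos_pi_rat_iff by (rule exI[of _ 1]) simp

lemma ex_add_inverse: "\<exists>u. u \<noteq> 0 \<and> w = u + inverse (u::complex)"
proof -
  define u where "u = (w + csqrt (w ^ 2 - 4)) / 2"
  have "(2 * u - w) ^ 2 = w ^ 2 - 4"
    by (simp add: u_def)
  then have "4 * (u * (w - u)) = 4"
    by (simp add: power2_eq_square algebra_simps)
  then have *: "u * (w - u) = 1" by simp
  then have "u \<noteq> 0" by auto
  moreover have "w = u + inverse u"
    using inverse_unique[OF *] by simp
  ultimately show ?thesis by blast
qed

text \<open>An eigenvalue of the recurrence \<open>e (n + 2) = w * e (n + 1) - e n\<close>. The two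
  candidates are mutually inverse, so whether it is a root of unity does not depend on the
  choice.\<close>

definition eig :: "complex \<Rightarrow> complex" where
  "eig w = (SOME u. u \<noteq> 0 \<and> w = u + inverse u)"

lemma eig_nonzero [simp]: "eig w \<noteq> 0" and eig_add_inverse: "eig w + inverse (eig w) = w"
proof -
  have "eig w \<noteq> 0 \<and> w = eig w + inverse (eig w)"
    unfolding eig_def by (rule someI_ex[OF ex_add_inverse])
  then show "eig w \<noteq> 0" "eig w + inverse (eig w) = w" by metis+
qed

lemma root_of_unity_eig_iff: "root_of_unity (eig w) \<longleftrightarrow> w \<in> two_cos_pi_rat"
proof
  assume "w \<in> two_cos_pi_rat"
  then obtain u where u: "root_of_unity u" "w = u + inverse u"
    unfolding two_cos_pi_rat_iff by blast
  have nz: "u \<noteq> 0" using u by (simp add: root_of_unity_nonzero)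
  define e where "e = eig w"
  have e: "e \<noteq> 0" "e + inverse e = u + inverse u"
    using u(2) by (simp_all add: e_def eig_add_inverse)
  have "(e - u) * (e - inverse u) = e * (e + inverse e - (u + inverse u))"
    using nz e(1) by (simp add: algebra_simps)
  also have "\<dots> = 0" by (simp add: e(2))
  finally have "e = u \<or> e = inverse u" by simp
  then show "root_of_unity (eig w)"
    using u(1) root_of_unity_inverse unfolding e_def by metis
next
  assume "root_of_unity (eig w)"
  then show "w \<in> two_cos_pi_rat"
    unfolding two_cos_pi_rat_iff by (intro exI[of _ "eig w"]) (simp add: eig_add_inverse)
qed

text \<open>The sequence \<open>e (Suc n) - u * e n\<close> is geometric with ratio
  \<open>inverse u\<close>. Either it is nonzero and yields \<open>c\<close>, or it vanishes and
  \<open>e\<close> itself is geometric with ratio \<open>u\<close>. This covers the double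
  eigenvalue at \<open>x = 2\<close> and \<open>x = - 2\<close> as well.\<close>

lemma linear_recurrence_multiplier:
  fixes e :: "nat \<Rightarrow> complex"
  assumes rec: "\<And>n. e (Suc (Suc n)) = x * e (Suc n) - e n"
    and per: "e N = c * e 0" "e (Suc N) = c * e 1"
    and nz: "e 0 \<noteq> 0 \<or> e 1 \<noteq> 0"
  shows "c = eig x ^ N \<or> c = inverse (eig x) ^ N"
proof -
  define u where "u = eig x"
  have u: "u \<noteq> 0" "x = u + inverse u"
    by (simp_all add: u_def eig_add_inverse)
  have a: "e (Suc n) - u * e n = inverse u ^ n * (e 1 - u * e 0)" for n
  proof (induction n)
    case (Suc n)
    have "e (Suc (Suc n)) - u * e (Suc n) = inverse u * (e (Suc n) - u * e n)"
      using u by (simp add: rec algebra_simps)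
    then show ?case by (simp add: Suc)
  qed simp
  show ?thesis
  proof (cases "e 1 - u * e 0 = 0")
    case True
    then have "e (Suc n) = u * e n" for n
      using a[of n] by simp
    then have "e n = u ^ n * e 0" for n
      by (induction n) auto
    from this[of N] have "e N = u ^ N * e 0" .
    moreover have "e 0 \<noteq> 0"
      using nz True by auto
    ultimately show ?thesis
      using per(1) by (simp add: u_def)
  next
    case False
    have "c * (e 1 - u * e 0) = inverse u ^ N * (e 1 - u * e 0)"
      using a[of N] by (simp add: per algebra_simps)
    with False show ?thesis by (simp add: u_def)
  qed
qed

lemma ex_common_period:
  assumes "finite A" "bij_betw \<rho> A A"
  obtains N where "N > 0" "\<And>m. m \<in> A \<Longrightarrow> (\<rho> ^^ N) m = m"
proof -
  have bij: "bij_betw (\<rho> ^^ n) A A" for n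
    using bij_betw_funpow[OF assms(2)] .
  have in_A: "(\<rho> ^^ n) m \<in> A" if "m \<in> A" for n m
    using bij[of n] that by (auto simp: bij_betw_def)
  then have "range (\<lambda>n. restrict (\<rho> ^^ n) A) \<subseteq> A \<rightarrow>\<^sub>E A"
    by auto
  then have "finite (range (\<lambda>n. restrict (\<rho> ^^ n) A))"
    by (rule finite_subset) (auto intro: finite_PiE assms(1))
  then have "\<not> inj (\<lambda>n::nat. restrict (\<rho> ^^ n) A)"
    using finite_imageD infinite_UNIV_nat by blast
  then obtain i j :: nat where ij: "i \<noteq> j" "restrict (\<rho> ^^ i) A = restrict (\<rho> ^^ j) A"
    by (auto simp: inj_def)
  have "\<exists>N>0. \<forall>m\<in>A. (\<rho> ^^ N) m = m" if "i < j" "restrict (\<rho> ^^ i) A = restrict (\<rho> ^^ j) A" for i j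
  proof (intro exI[of _ "j - i"] conjI ballI)
    fix m assume m: "m \<in> A"
    have "(\<rho> ^^ i) ((\<rho> ^^ (j - i)) m) = (\<rho> ^^ j) m"
      using that(1) funpow_add[of i "j - i" \<rho>] by simp
    also have "\<dots> = (\<rho> ^^ i) m"
      using fun_cong[OF that(2), of m] m by simp
    finally show "(\<rho> ^^ (j - i)) m = m"
      using bij[of i] in_A m unfolding bij_betw_def by (meson inj_onD)
  qed (use that in auto)
  with ij that show ?thesis
    by (metis linorder_neqE_nat)
qed

text \<open>Writing \<open>- k\<close> as the quotient of consecutive terms of a sequence
  \<open>D\<close> turns the fractional linear recurrence into a linear one, so the product of
  \<open>- k\<close> over a period is a multiplier of that recurrence.\<close>

lemma prod_cycles:
  fixes k \<xi> :: "'a \<Rightarrow> complex"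
  assumes A: "finite A" "bij_betw \<rho> A A"
    and k0: "\<And>m. m \<in> A \<Longrightarrow> k m \<noteq> 0"
    and \<xi>: "\<And>m. m \<in> A \<Longrightarrow> \<xi> (\<rho> m) = \<xi> m"
    and k: "\<And>m. m \<in> A \<Longrightarrow> k (\<rho> m) = - \<xi> m - inverse (k m)"
  obtains E :: "'a \<Rightarrow> int" where "\<And>m. \<bar>E m\<bar> \<le> 1"
    "root_of_unity (prod k A * (\<Prod>m\<in>A. eig (\<xi> m) powi E m))"
proof -
  obtain N where N: "N > 0" "\<And>m. m \<in> A \<Longrightarrow> (\<rho> ^^ N) m = m"
    using ex_common_period[OF A] by blast
  have bij: "bij_betw (\<rho> ^^ n) A A" for n
    using bij_betw_funpow[OF A(2)] .
  have in_A: "(\<rho> ^^ n) m \<in> A" if "m \<in> A" for n m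
    using bij[of n] that by (auto simp: bij_betw_def)
  have \<xi>n: "\<xi> ((\<rho> ^^ n) m) = \<xi> m" if "m \<in> A" for n m
    by (induction n) (auto simp: \<xi> in_A that)
  define D where "D m n = (\<Prod>i<n. - k ((\<rho> ^^ i) m))" for m n
  have "\<exists>e::int. \<bar>e\<bar> \<le> 1 \<and> D m N * (eig (\<xi> m) powi e) ^ N = 1" if m: "m \<in> A" for m
  proof -
    have "D m N = eig (\<xi> m) ^ N \<or> D m N = inverse (eig (\<xi> m)) ^ N"
    proof (rule linear_recurrence_multiplier)
      fix n
      show "D m (Suc (Suc n)) = \<xi> m * D m (Suc n) - D m n"
        using k0[OF in_A[OF m, of n]]
        by (simp add: D_def \<xi>n[OF m] k[OF in_A[OF m, of n]] algebra_simps)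
    next
      show "D m (Suc N) = D m N * D m 1"
        using N(2)[OF m] by (simp add: D_def)
    qed (simp_all add: D_def)
    then show ?thesis
    proof
      assume "D m N = eig (\<xi> m) ^ N"
      then show ?thesis
        by (intro exI[of _ "- 1"]) (simp add: power_int_minus power_inverse)
    next
      assume "D m N = inverse (eig (\<xi> m)) ^ N"
      then show ?thesis
        by (intro exI[of _ 1]) (simp add: power_inverse)
    qed
  qed
  then obtain E0 :: "'a \<Rightarrow> int" where E0: "\<And>m. m \<in> A \<Longrightarrow> \<bar>E0 m\<bar> \<le> 1"
    "\<And>m. m \<in> A \<Longrightarrow> D m N * (eig (\<xi> m) powi E0 m) ^ N = 1"
    using bchoice[of A "\<lambda>m e::int. \<bar>e\<bar> \<le> 1 \<and> D m N * (eig (\<xi> m) powi e) ^ N = 1"] by blast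
  \<comment> \<open>Each \<open>\<rho> ^^ i\<close> permutes \<open>A\<close>, so every factor is
    collected exactly \<open>N\<close> times.\<close>
  have "(\<Prod>m\<in>A. D m N) = (\<Prod>i<N. \<Prod>m\<in>A. - k ((\<rho> ^^ i) m))"
    unfolding D_def by (rule prod.swap)
  also have "\<dots> = (\<Prod>i<N. \<Prod>m\<in>A. - k m)"
    by (intro prod.cong refl prod.reindex_bij_betw[OF bij, where g = "\<lambda>m. - k m"])
  also have "\<dots> = (\<Prod>m\<in>A. - k m) ^ N" by simp
  finally have DN: "(\<Prod>m\<in>A. D m N) = (\<Prod>m\<in>A. - k m) ^ N" .
  have "((\<Prod>m\<in>A. - k m) * (\<Prod>m\<in>A. eig (\<xi> m) powi E0 m)) ^ N
      = (\<Prod>m\<in>A. D m N * (eig (\<xi> m) powi E0 m) ^ N)"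
    by (simp only: prod.distrib DN prod_power_distrib power_mult_distrib)
  also have "\<dots> = 1" using E0(2) by simp
  finally have 1: "root_of_unity ((\<Prod>m\<in>A. - k m) * (\<Prod>m\<in>A. eig (\<xi> m) powi E0 m))"
    using N(1) by (rule root_of_unityI)
  have 2: "(\<Prod>m\<in>A. - k m) = (- 1) ^ card A * prod k A"
    using prod.distrib[of "\<lambda>_. - 1" k A] by simp
  have "root_of_unity (prod k A * (\<Prod>m\<in>A. eig (\<xi> m) powi E0 m))"
    using 1 unfolding 2 mult.assoc by simp
  \<comment> \<open>The exponent is set to 0 outside \<open>A\<close>, so that the bound holds for
    every \<open>m\<close>.\<close>
  moreover have "(\<Prod>m\<in>A. eig (\<xi> m) powi (if m \<in> A then E0 m else 0))
      = (\<Prod>m\<in>A. eig (\<xi> m) powi E0 m)"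
    by (rule prod.cong) auto
  ultimately have "root_of_unity (prod k A * (\<Prod>m\<in>A. eig (\<xi> m) powi (if m \<in> A then E0 m else 0)))"
    by (simp only:)
  moreover have "\<bar>if m \<in> A then E0 m else 0\<bar> \<le> 1" for m
    using E0(1)[of m] by simp
  ultimately show ?thesis by (rule that[rotated])
qed

text \<open>
  Along the cycle through \<open>q\<close> and \<open>p\<close> the function \<open>k\<close> runs through \<open>0\<close> and \<open>\<infinity>\<close>
  (at \<open>p\<close> its actual value is irrelevant).
\<close>

lemma prod_cycles_pole:
  fixes k \<xi> :: "'a \<Rightarrow> complex"
  assumes S: "finite S" "bij_betw \<rho> S S"
    and pq: "p \<in> S" "q \<in> S" "p \<noteq> q" "\<rho> q = p" "k q = 0" "k (\<rho> p) = - \<xi> p"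
    and \<xi>p: "\<xi> p \<in> two_cos_pi_rat"
    and k0: "\<And>m. m \<in> S - {p, q} \<Longrightarrow> k m \<noteq> 0"
    and \<xi>: "\<And>m. m \<in> S \<Longrightarrow> \<xi> (\<rho> m) = \<xi> m"
    and k: "\<And>m. m \<in> S - {p, q} \<Longrightarrow> k (\<rho> m) = - \<xi> m - inverse (k m)"
  shows "\<exists>E :: 'a \<Rightarrow> int. (\<forall>m. \<bar>E m\<bar> \<le> 1) \<and>
    root_of_unity (prod k (S - {p, q}) * (\<Prod>m\<in>S. eig (\<xi> m) powi E m))"
proof -
  define v where "v n = (\<rho> ^^ n) q" for n
  have v_simps [simp]: "v 0 = q" "v (Suc n) = \<rho> (v n)" for n
    by (simp_all add: v_def)
  have v1: "v 1 = p" using pq by simp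
  have vS: "v n \<in> S" for n
    by (induction n) (use pq S in \<open>auto simp: bij_betw_def\<close>)
  obtain N1 where "N1 > 0" "v N1 = q"
    using ex_common_period[OF S] pq(2) v_def by metis
  \<comment> \<open>The length of the cycle through \<open>q\<close> and \<open>p\<close>. Away from
    this cycle, called \<open>B\<close> below, \<open>prod_cycles\<close> applies.\<close>
  define N where "N = (LEAST n. n > 0 \<and> v n = q)"
  have N: "N > 0" "v N = q"
    using LeastI[of "\<lambda>n. n > 0 \<and> v n = q" N1] \<open>N1 > 0\<close> \<open>v N1 = q\<close> by (auto simp: N_def)
  have N_min: "v n \<noteq> q" if "0 < n" "n < N" for n
    using not_less_Least[of n "\<lambda>n. n > 0 \<and> v n = q"] that by (auto simp: N_def)
  have "N \<noteq> 1" using N(2) v1 pq(3) by metis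
  with N(1) have N2: "N \<ge> 2" by auto
  have inj: "inj_on v {..<N}"
  proof -
    have "i = j" if "i \<le> j" "j < N" "v i = v j" for i j
      using that
    proof (induction i arbitrary: j)
      case 0
      then show ?case using N_min[of j] by (cases j) (metis v_simps(1) zero_less_Suc)+
    next
      case (Suc i)
      then obtain j' where j: "j = Suc j'" by (cases j) auto
      have "v i = v j'"
        using Suc.prems vS S(2) by (auto simp: j bij_betw_def inj_on_def)
      then show ?case using Suc by (auto simp: j)
    qed
    then show ?thesis
      by (intro inj_onI) (metis lessThan_iff linorder_le_cases)
  qed
  define B where "B = v ` {..<N}"
  have BS: "B \<subseteq> S" using vS by (auto simp: B_def)
  have pqB: "q \<in> B" "p \<in> B"
    using N2 v1 image_eqI[of q v 0 "{..<N}"] image_eqI[of p v 1 "{..<N}"] by (simp_all add: B_def)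
  have \<rho>B: "\<rho> ` B = B"
  proof -
    have "\<rho> m \<in> B" if m: "m \<in> B" for m
    proof -
      obtain n where n: "n < N" "m = v n" using m by (auto simp: B_def)
      show ?thesis
      proof (cases "Suc n < N")
        case True
        then show ?thesis using n unfolding B_def by (intro image_eqI[of _ _ "Suc n"]) auto
      next
        case False
        then have "Suc n = N" using n by simp
        then have "\<rho> m = q" using n N(2) by auto
        then show ?thesis using pqB by simp
      qed
    qed
    then have "\<rho> ` B \<subseteq> B" by blast
    moreover have "card (\<rho> ` B) = card B"
      using S(2) BS by (intro card_image) (auto simp: bij_betw_def inj_on_def)
    moreover have "finite B" by (simp add: B_def)
    ultimately show ?thesis by (simp add: card_subset_eq)
  qed
  have bijA: "bij_betw \<rho> (S - B) (S - B)"
    using S(2) BS \<rho>B unfolding bij_betw_def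
    by (metis Diff_subset inj_on_image_set_diff inj_on_subset)
  obtain E0 :: "'a \<Rightarrow> int" where E0: "\<And>m. \<bar>E0 m\<bar> \<le> 1"
    "root_of_unity (prod k (S - B) * (\<Prod>m\<in>S - B. eig (\<xi> m) powi E0 m))"
  proof (rule prod_cycles[of "S - B" \<rho> k \<xi>])
    fix m assume "m \<in> S - B"
    then have m: "m \<in> S - {p, q}" using pqB by auto
    show "k m \<noteq> 0" "\<xi> (\<rho> m) = \<xi> m" "k (\<rho> m) = - \<xi> m - inverse (k m)"
      using m k0 \<xi> k by auto
  qed (use S bijA in auto)
  define x where "x = \<xi> p"
  have \<xi>v: "\<xi> (v n) = x" for n
  proof -
    have "\<xi> (v n) = \<xi> q" by (induction n) (auto simp: \<xi> vS)
    then show ?thesis using \<xi>[OF pq(2)] pq(4) by (simp add: x_def)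
  qed
  \<comment> \<open>The linear recurrence starts at \<open>q\<close> with \<open>D 0 = 1\<close>.
    Here \<open>D 1 = 0\<close> encodes \<open>k q = 0\<close>, and continuing to
    \<open>D 2 = - 1\<close> passes the pole at \<open>p\<close>. From index 2 on, the quotients of
    \<open>D\<close> are \<open>- k\<close> again.\<close>
  define D where "D n = fst (((\<lambda>(a, b). (b, x * b - a)) ^^ n) (1, 0))" for n
  have snd: "snd (((\<lambda>(a, b). (b, x * b - a)) ^^ n) (1, 0)) = D (Suc n)" for n
    by (simp add: D_def case_prod_beta)
  have D: "D (Suc (Suc n)) = x * D (Suc n) - D n" for n
    using snd[of n] snd[of "Suc n"] by (simp add: D_def case_prod_beta)
  have D01: "D 0 = 1" "D (Suc 0) = 0" by (simp_all add: D_def)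
  have Dk: "D (Suc n) = - k (v n) * D n" if "2 \<le> n" "n \<le> N" for n
    using that
  proof (induction n rule: dec_induct)
    case base
    have "v 2 = \<rho> p" using v1 by (simp add: numeral_2_eq_2)
    then show ?case
      using pq(6) by (simp add: numeral_2_eq_2 D D01 x_def)
  next
    case (step n)
    have "v n \<in> S - {p, q}"
    proof -
      have "v n \<noteq> v 0" "v n \<noteq> v 1"
        using inj_on_eq_iff[OF inj, of n 0] inj_on_eq_iff[OF inj, of n 1] step N2 by auto
      then show ?thesis using vS v1 by auto
    qed
    then have kn: "k (v n) \<noteq> 0" "k (v (Suc n)) = - x - inverse (k (v n))"
      using k0 k \<xi>v by auto
    have "inverse (k (v n)) * D (Suc n) = - D n"
      using step kn(1) by simp
    then show ?case
      unfolding D kn(2) by (simp add: algebra_simps)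
  qed
  have D_prod: "D n = - (\<Prod>i\<in>{2..<n}. - k (v i))" if "2 \<le> n" "n \<le> N" for n
    using that
  proof (induction n rule: dec_induct)
    case base
    show ?case by (simp add: numeral_2_eq_2 D D01)
  next
    case (step n)
    then show ?case using Dk[of n] by (simp add: atLeastLessThanSuc)
  qed
  \<comment> \<open>Since \<open>k\<close> vanishes at \<open>v N = q\<close>, also
    \<open>D (Suc N) = 0\<close>, and \<open>D N\<close> is the multiplier of the cycle. It is
    torsion because \<open>\<xi> p\<close> lies in \<open>two_cos_pi_rat\<close>.\<close>
  have "D N = eig x ^ N \<or> D N = inverse (eig x) ^ N"
  proof (rule linear_recurrence_multiplier)
    show "D (Suc N) = D N * D 1"
      using Dk[of N] N N2 pq(5) by (simp add: D01)
  qed (simp_all add: D D01)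
  then have "root_of_unity (D N)"
    using \<xi>p root_of_unity_eig_iff root_of_unity_power root_of_unity_inverse unfolding x_def by metis
  then have "root_of_unity (\<Prod>i\<in>{2..<N}. - k (v i))"
    using D_prod[of N] N2 by simp
  moreover have "(\<Prod>i\<in>{2..<N}. - k (v i)) = (- 1) ^ (N - 2) * (\<Prod>i\<in>{2..<N}. k (v i))"
    using prod.distrib[of "\<lambda>_. - 1" "\<lambda>i. k (v i)" "{2..<N}"] by simp
  moreover have "(\<Prod>i\<in>{2..<N}. k (v i)) = prod k (B - {p, q})"
  proof -
    have "{2..<N} = {..<N} - {0, 1}" by auto
    then have "B - {p, q} = v ` {2..<N}"
      using inj N2 v1 unfolding B_def
      by (subst \<open>{2..<N} = _\<close>, subst inj_on_image_set_diff[of v "{..<N}"]) (auto simp del: v_simps(2))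
    moreover have "inj_on v {2..<N}" using inj by (rule inj_on_subset) auto
    ultimately show ?thesis by (simp add: prod.reindex)
  qed
  ultimately have 2: "root_of_unity (prod k (B - {p, q}))" by simp
  \<comment> \<open>The cycle through \<open>p\<close> and \<open>q\<close> contributes only
    torsion, hence the exponent 0 there.\<close>
  define E where "E m = (if m \<in> B then 0 else E0 m)" for m
  have "prod k (S - {p, q}) = prod k (S - B) * prod k (B - {p, q})"
    using S(1) BS pqB
    by (subst prod.union_disjoint[symmetric]) (auto intro!: prod.cong intro: finite_subset)
  moreover have "(\<Prod>m\<in>S. eig (\<xi> m) powi E m) = (\<Prod>m\<in>S - B. eig (\<xi> m) powi E0 m)"
    using S(1) BS by (intro prod.mono_neutral_cong_right) (auto simp: E_def)
  ultimately have "root_of_unity (prod k (S - {p, q}) * (\<Prod>m\<in>S. eig (\<xi> m) powi E m))"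
    using root_of_unity_mult[OF E0(2) 2] by (simp add: mult_ac)
  moreover have "\<forall>m. \<bar>E m\<bar> \<le> 1"
    using E0(1) by (simp add: E_def)
  ultimately show ?thesis by blast
qed

text \<open>Eliminating one unknown preserves strict diagonal dominance (Schur complement).\<close>

lemma root_of_unity_diag_dominant:
  fixes c :: "'a \<Rightarrow> complex" and A :: "'a \<Rightarrow> 'a \<Rightarrow> int"
  assumes "finite P"
    and "\<And>p. p \<in> P \<Longrightarrow> c p \<noteq> 0"
    and "\<And>p. p \<in> P \<Longrightarrow> (\<Sum>q\<in>P - {p}. \<bar>A p q\<bar>) < A p p"
    and "\<And>p. p \<in> P \<Longrightarrow> root_of_unity (\<Prod>q\<in>P. c q powi A p q)"
    and "p \<in> P"
  shows "root_of_unity (c p)"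
  using assms
proof (induction P arbitrary: A p rule: finite_induct)
  case (insert r P)
  note dom = insert.prems(2) and unit = insert.prems(3)
  have c0: "c r \<noteq> 0" "\<And>q. q \<in> P \<Longrightarrow> c q \<noteq> 0" using insert.prems(1) by blast+
  \<comment> \<open>Row \<open>p\<close> times \<open>A r r\<close> minus row \<open>r\<close> times
    \<open>A p r\<close>: elimination without division, so the exponents stay integers.\<close>
  define A' where "A' p q = A r r * A p q - A p r * A r q" for p q
  have r: "(\<Sum>q\<in>P. \<bar>A r q\<bar>) < A r r"
    using dom[of r] insert.hyps by simp
  have Arr: "A r r > 0"
    using r sum_nonneg[of P "\<lambda>q. \<bar>A r q\<bar>"] by (meson abs_ge_zero le_less_trans)
  have *: "root_of_unity (c q)" if q: "q \<in> P" for q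
  proof (rule insert.IH[of A'])
    fix p assume p: "p \<in> P"
    have rp: "r \<noteq> p" using p insert.hyps by auto
    have 1: "\<bar>A p r\<bar> + (\<Sum>q\<in>P - {p}. \<bar>A p q\<bar>) < A p p"
    proof -
      have "insert r P - {p} = insert r (P - {p})" using rp by auto
      then show ?thesis using dom[of p] p insert.hyps by simp
    qed
    have 2: "\<bar>A r p\<bar> + (\<Sum>q\<in>P - {p}. \<bar>A r q\<bar>) < A r r"
      using r p insert.hyps by (simp add: sum.remove)
    have "(\<Sum>q\<in>P - {p}. \<bar>A' p q\<bar>) \<le> (\<Sum>q\<in>P - {p}. A r r * \<bar>A p q\<bar> + \<bar>A p r\<bar> * \<bar>A r q\<bar>)"
      using Arr unfolding A'_def by (intro sum_mono) (metis abs_mult abs_of_pos abs_triangle_ineq4)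
    also have "\<dots> = A r r * (\<Sum>q\<in>P - {p}. \<bar>A p q\<bar>) + \<bar>A p r\<bar> * (\<Sum>q\<in>P - {p}. \<bar>A r q\<bar>)"
      by (simp add: sum.distrib sum_distrib_left)
    also have "\<dots> < A r r * (A p p - \<bar>A p r\<bar>) + \<bar>A p r\<bar> * (A r r - \<bar>A r p\<bar>)"
      using 1 2 Arr by (intro add_less_le_mono mult_strict_left_mono mult_left_mono) auto
    also have "\<dots> = A r r * A p p - \<bar>A p r * A r p\<bar>"
      by (simp add: algebra_simps abs_mult)
    also have "\<dots> \<le> A' p p" unfolding A'_def by linarith
    finally show "(\<Sum>q\<in>P - {p}. \<bar>A' p q\<bar>) < A' p p" .
    have row: "(\<Prod>q\<in>insert r P. c q powi A i q) = c r powi A i r * (\<Prod>q\<in>P. c q powi A i q)" for i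
      using insert.hyps by simp
    \<comment> \<open>The same row operation on the multiplicative relations; the powers of
      \<open>c r\<close> cancel.\<close>
    have "(\<Prod>q\<in>insert r P. c q powi A p q) powi A r r / (\<Prod>q\<in>insert r P. c q powi A r q) powi A p r
      = (\<Prod>q\<in>P. c q powi A' p q)"
    proof -
      have "(\<Prod>q\<in>P. c q powi A' p q)
          = (\<Prod>q\<in>P. (c q powi A p q) powi A r r / (c q powi A r q) powi A p r)"
        using c0(2) unfolding A'_def
        by (intro prod.cong) (auto simp: power_int_diff mult.commute simp flip: power_int_mult)
      also have "\<dots> = (\<Prod>q\<in>P. c q powi A p q) powi A r r / (\<Prod>q\<in>P. c q powi A r q) powi A p r"
        by (simp add: prod_dividef prod_powi)
      also have "\<dots> = (c r powi A p r) powi A r r * (\<Prod>q\<in>P. c q powi A p q) powi A r r /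
                  ((c r powi A r r) powi A p r * (\<Prod>q\<in>P. c q powi A r q) powi A p r)"
        using c0(1) by (simp add: mult.commute flip: power_int_mult)
      finally show ?thesis by (simp add: row power_int_mult_distrib)
    qed
    moreover have "root_of_unity ((\<Prod>q\<in>insert r P. c q powi A p q) powi A r r /
        (\<Prod>q\<in>insert r P. c q powi A r q) powi A p r)"
      using p by (intro root_of_unity_divide root_of_unity_powi unit) auto
    ultimately show "root_of_unity (\<Prod>q\<in>P. c q powi A' p q)" by simp
  qed (use q c0 in auto)
  \<comment> \<open>Back substitution in row \<open>r\<close>.\<close>
  have "root_of_unity (c r)"
  proof -
    have "root_of_unity (c r powi A r r * (\<Prod>q\<in>P. c q powi A r q))"
      using unit[of r] insert.hyps by simp
    moreover have p: "root_of_unity (\<Prod>q\<in>P. c q powi A r q)"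
      by (intro root_of_unity_prod root_of_unity_powi *)
    ultimately have "root_of_unity (c r powi A r r)"
      using root_of_unity_divide root_of_unity_nonzero[OF p] by fastforce
    then have "root_of_unity (c r ^ nat (A r r))"
      using Arr by (simp add: power_int_def)
    then show ?thesis using root_of_unity_power_iff Arr by simp
  qed
  then show ?case using * insert.prems(4) by auto
qed simp

section \<open>Systems of flips\<close>

text \<open>Coordinates are functions on an abstract point set, so the locale serves both the
  surface and its flip-invariant subsets. The cyclic form of the assumptions makes a rotation of the
  coordinates another instance, and results about \<open>z\<close> transfer to \<open>x\<close> and
  \<open>y\<close>.\<close>

locale flip_system =
  fixes S :: "'a set" and s1 s2 s3 :: "'a \<Rightarrow> 'a" and x y z :: "'a \<Rightarrow> complex"
    and \<theta>1 \<theta>2 \<theta>3 \<theta>4 :: complex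
  assumes closed: "m \<in> S \<Longrightarrow> s1 m \<in> S" "m \<in> S \<Longrightarrow> s2 m \<in> S" "m \<in> S \<Longrightarrow> s3 m \<in> S"
    and s1: "m \<in> S \<Longrightarrow> x (s1 m) = \<theta>1 - x m - y m * z m"
      "m \<in> S \<Longrightarrow> y (s1 m) = y m" "m \<in> S \<Longrightarrow> z (s1 m) = z m"
    and s2: "m \<in> S \<Longrightarrow> y (s2 m) = \<theta>2 - y m - z m * x m"
      "m \<in> S \<Longrightarrow> z (s2 m) = z m" "m \<in> S \<Longrightarrow> x (s2 m) = x m"
    and s3: "m \<in> S \<Longrightarrow> z (s3 m) = \<theta>3 - z m - x m * y m"
      "m \<in> S \<Longrightarrow> x (s3 m) = x m" "m \<in> S \<Longrightarrow> y (s3 m) = y m"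
    and ext: "m \<in> S \<Longrightarrow> m' \<in> S \<Longrightarrow> x m = x m' \<Longrightarrow> y m = y m' \<Longrightarrow> z m = z m' \<Longrightarrow> m = m'"
    and surface: "m \<in> S \<Longrightarrow> x m * y m * z m + x m ^ 2 + y m ^ 2 + z m ^ 2
      - \<theta>1 * x m - \<theta>2 * y m - \<theta>3 * z m + \<theta>4 = 0"
begin

lemma flip_system_rotate: "flip_system S s2 s3 s1 y z x \<theta>2 \<theta>3 \<theta>1 \<theta>4"
proof
  fix m assume m: "m \<in> S"
  show "y m * z m * x m + y m ^ 2 + z m ^ 2 + x m ^ 2
      - \<theta>2 * y m - \<theta>3 * z m - \<theta>1 * x m + \<theta>4 = 0"
    using surface[OF m] by (simp add: algebra_simps)
qed (use closed s1 s2 s3 ext in auto)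

lemma involution: "m \<in> S \<Longrightarrow> s1 (s1 m) = m" "m \<in> S \<Longrightarrow> s2 (s2 m) = m" "m \<in> S \<Longrightarrow> s3 (s3 m) = m"
  by (rule ext; simp add: closed s1 s2 s3)+

text \<open>
  The composition \<open>s1 \<circ> s2\<close> acts on a level set of \<open>z\<close> by an affine map. The differences of
  consecutive values of \<open>x\<close> and \<open>y\<close> satisfy a linear recurrence, which has no nonzero
  periodic solution unless the multiplier is a root of unity.
\<close>

lemma fixed_if_periodic:
  assumes m: "m \<in> S" and N: "N > 0" "((s1 \<circ> s2) ^^ N) m = m" and zbad: "z m \<notin> two_cos_pi_rat"
  shows "s1 m = m \<and> s2 m = m"
proof -
  define v where "v n = ((s1 \<circ> s2) ^^ n) m" for n
  have v: "v 0 = m" "v (Suc n) = s1 (s2 (v n))" for n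
    by (simp_all add: v_def)
  have vS: "v n \<in> S" for n
    by (induction n) (auto simp: v m closed)
  have vN: "v N = m" "v (Suc N) = v 1"
    using N(2) by (simp_all add: v_def)
  have zv: "z (v n) = z m" for n
    by (induction n) (auto simp: v s1 s2 vS closed)
  define a where "a n = y (v (Suc n)) - y (v n)" for n
  define b where "b n = x (v (Suc n)) - x (v n)" for n
  have yv: "y (v (Suc n)) = \<theta>2 - y (v n) - z m * x (v n)" for n
    by (simp add: v s1 s2 closed vS zv)
  have xv: "x (v (Suc n)) = \<theta>1 - x (v n) - y (v (Suc n)) * z m" for n
    by (simp add: v s1 s2 closed vS zv)
  have ab: "a (Suc n) = - z m * b n - a n" "b (Suc n) = - z m * a (Suc n) - b n" for n
    unfolding a_def b_def
    by (subst (1 2) yv, simp add: algebra_simps) (subst (1 2) xv, simp add: algebra_simps)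
  \<comment> \<open>Interleaving the two difference sequences merges the coupled system into one
    scalar recurrence with coefficient \<open>- z m\<close>; a period \<open>N\<close> becomes
    \<open>2 * N\<close>.\<close>
  define e where "e n = (if even n then a (n div 2) else b (n div 2))" for n
  have "a 0 = 0 \<and> b 0 = 0"
  proof (rule ccontr)
    assume "\<not> (a 0 = 0 \<and> b 0 = 0)"
    then have nz: "e 0 \<noteq> 0 \<or> e 1 \<noteq> 0" by (auto simp: e_def)
    have per: "e (2 * N) = 1 * e 0" "e (Suc (2 * N)) = 1 * e 1"
      using vN v(1) by (simp_all add: e_def a_def b_def)
    have rec: "e (Suc (Suc n)) = (- z m) * e (Suc n) - e n" for n
      by (cases "even n") (auto simp: e_def ab elim!: evenE oddE)
    have "1 = eig (- z m) ^ (2 * N) \<or> 1 = inverse (eig (- z m)) ^ (2 * N)"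
      by (rule linear_recurrence_multiplier[OF rec per nz])
    then have "root_of_unity (eig (- z m))"
      using N(1) by (auto simp: power_inverse intro!: root_of_unityI[of _ "2 * N"])
    then show False
      using zbad by (simp add: root_of_unity_eig_iff two_cos_pi_rat_uminus_iff)
  qed
  then have 1: "y (v 1) = y m" "x (v 1) = x m"
    by (auto simp: a_def b_def v)
  have s2m: "s2 m = m"
    using m 1(1) by (intro ext) (auto simp: closed s1 s2 v)
  moreover have "s1 m = m"
    using m 1(2) s2m by (intro ext) (auto simp: closed s1 s2 v)
  ultimately show ?thesis by blast
qed

end

section \<open>Bad points of a finite orbit\<close>

text \<open>The assumption \<open>connected\<close> expresses transitivity of the full flip group
  without a group. Five points are more than a point and its three flips, which is what
  \<open>card_bad\<close> exploits.\<close>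

locale finite_flip_orbit = flip_system +
  assumes finite_S: "finite S"
    and connected: "A \<subseteq> S \<Longrightarrow> A \<noteq> {} \<Longrightarrow> (\<And>m. m \<in> A \<Longrightarrow> s1 m \<in> A \<and> s2 m \<in> A \<and> s3 m \<in> A) \<Longrightarrow> A = S"
    and card_S: "card S \<ge> 5"
begin

lemma finite_flip_orbit_rotate: "finite_flip_orbit S s2 s3 s1 y z x \<theta>2 \<theta>3 \<theta>1 \<theta>4"
  by (intro finite_flip_orbit.intro flip_system_rotate finite_flip_orbit_axioms.intro
      finite_S connected card_S) auto

definition bad :: "'a set" where
  "bad = {m \<in> S. x m \<notin> two_cos_pi_rat \<or> y m \<notin> two_cos_pi_rat \<or> z m \<notin> two_cos_pi_rat}"

text \<open>A bad point has only one bad coordinate, so up to torsion this is the multiplier there.\<close>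

definition mult_at :: "'a \<Rightarrow> complex" where
  "mult_at m = eig (x m) * eig (y m) * eig (z m)"

lemma bij_flips: "bij_betw s1 S S" "bij_betw s2 S S" "bij_betw s3 S S"
  by (rule bij_betw_byWitness[where f' = s1] bij_betw_byWitness[where f' = s2]
      bij_betw_byWitness[where f' = s3]; use closed involution in auto)+

lemma z_bad_fixed:
  assumes "m \<in> S" "z m \<notin> two_cos_pi_rat"
  shows "s1 m = m" "s2 m = m"
proof -
  obtain N where "N > 0" "\<And>m. m \<in> S \<Longrightarrow> ((s1 \<circ> s2) ^^ N) m = m"
    using ex_common_period[OF finite_S bij_betw_trans[OF bij_flips(2) bij_flips(1)]] by blast
  then show "s1 m = m" "s2 m = m"
    using fixed_if_periodic assms by blast+
qed

lemma connected_le: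
  assumes "set ms \<subseteq> S" "ms \<noteq> []" "\<And>m. m \<in> set ms \<Longrightarrow> s1 m \<in> set ms \<and> s2 m \<in> set ms \<and> s3 m \<in> set ms"
  shows "length ms \<ge> 5"
proof -
  have "set ms = S" using assms by (intro connected) auto
  then show ?thesis using card_S card_length[of ms] by simp
qed

lemma x_bad_fixed:
  assumes "m \<in> S" "x m \<notin> two_cos_pi_rat"
  shows "s2 m = m" "s3 m = m"
  using finite_flip_orbit.z_bad_fixed[OF finite_flip_orbit_rotate assms] by auto

lemma y_bad_fixed:
  assumes "m \<in> S" "y m \<notin> two_cos_pi_rat"
  shows "s3 m = m" "s1 m = m"
  using finite_flip_orbit.z_bad_fixed
    [OF finite_flip_orbit.finite_flip_orbit_rotate[OF finite_flip_orbit_rotate] assms] by auto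

text \<open>The point is fixed by \<open>s1\<close> and \<open>s2\<close>. A second bad coordinate
  would make it fixed by \<open>s3\<close> too, and then it would be the whole orbit.\<close>

lemma z_bad_unique:
  assumes "m \<in> S" "z m \<notin> two_cos_pi_rat"
  shows "s3 m \<noteq> m" "x m \<in> two_cos_pi_rat" "y m \<in> two_cos_pi_rat"
proof -
  show 1: "s3 m \<noteq> m"
    using connected_le[of "[m]"] z_bad_fixed[OF assms] assms(1) by auto
  show "x m \<in> two_cos_pi_rat"
    using x_bad_fixed(2)[OF assms(1)] 1 by blast
  show "y m \<in> two_cos_pi_rat"
    using y_bad_fixed(1)[OF assms(1)] 1 by blast
qed

text \<open>The flip \<open>s3\<close> keeps the good coordinates \<open>x\<close> and
  \<open>y\<close>, so only \<open>z\<close> could be bad at \<open>s3 m\<close>. Then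
  \<open>s1\<close> and \<open>s2\<close> would fix both points, and \<open>m\<close>,
  \<open>s3 m\<close> would form the whole orbit.\<close>

lemma z_bad_flip_not_bad:
  assumes m: "m \<in> S" "z m \<notin> two_cos_pi_rat"
  shows "s3 m \<notin> bad"
proof
  assume "s3 m \<in> bad"
  then have "z (s3 m) \<notin> two_cos_pi_rat"
    using z_bad_unique[OF m] m by (auto simp: bad_def s3)
  then have "s1 (s3 m) = s3 m" "s2 (s3 m) = s3 m"
    using z_bad_fixed closed m(1) by auto
  then have "length [m, s3 m] \<ge> 5"
    by (intro connected_le) (use z_bad_fixed[OF m] m(1) closed involution(3)[OF m(1)] in auto)
  then show False by simp
qed

lemma bad_neighbour:
  assumes "m \<in> bad"
  obtains n where "n \<in> S - bad" "m \<in> {s1 n, s2 n, s3 n}"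
proof -
  interpret r: finite_flip_orbit S s2 s3 s1 y z x \<theta>2 \<theta>3 \<theta>1 \<theta>4
    by (rule finite_flip_orbit_rotate)
  interpret rr: finite_flip_orbit S s3 s1 s2 z x y \<theta>3 \<theta>1 \<theta>2 \<theta>4
    by (rule r.finite_flip_orbit_rotate)
  have [simp]: "r.bad = bad" "rr.bad = bad"
    by (auto simp: bad_def r.bad_def rr.bad_def)
  have "m \<in> S" using assms by (auto simp: bad_def)
  from assms consider "z m \<notin> two_cos_pi_rat" | "x m \<notin> two_cos_pi_rat" | "y m \<notin> two_cos_pi_rat"
    unfolding bad_def by blast
  then show ?thesis
  proof cases
    case 1
    then show ?thesis
      using that[of "s3 m"] z_bad_flip_not_bad closed involution \<open>m \<in> S\<close> by simp
  next
    case 2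
    then show ?thesis
      using that[of "s1 m"] r.z_bad_flip_not_bad closed involution \<open>m \<in> S\<close> by simp
  next
    case 3
    then show ?thesis
      using that[of "s2 m"] rr.z_bad_flip_not_bad closed involution \<open>m \<in> S\<close> by simp
  qed
qed

text \<open>Every bad point is a flip of a good one. With at most one good point \<open>n\<close>,
  the orbit would consist of \<open>n\<close> and its three flips.\<close>

lemma card_bad: "card bad + 2 \<le> card S"
proof (rule ccontr)
  assume "\<not> ?thesis"
  moreover have bad: "bad \<subseteq> S" by (auto simp: bad_def)
  then have "card (S - bad) = card S - card bad" "card bad \<le> card S"
    using finite_S by (simp_all add: card_Diff_subset finite_subset[OF bad] card_mono)
  ultimately have "card (S - bad) \<le> 1" by simp
  then have eq: "n = n'" if "n \<in> S - bad" "n' \<in> S - bad" for n n'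
    using card_le_Suc0_iff_eq[of "S - bad"] finite_S that by auto
  obtain m where m: "m \<in> S" using card_S by fastforce
  obtain n where n: "n \<in> S - bad"
    using m bad_neighbour by blast
  have "S \<subseteq> {n, s1 n, s2 n, s3 n}"
  proof
    fix m assume "m \<in> S"
    show "m \<in> {n, s1 n, s2 n, s3 n}"
    proof (cases "m \<in> bad")
      case True
      then obtain n' where "n' \<in> S - bad" "m \<in> {s1 n', s2 n', s3 n'}" by (rule bad_neighbour)
      with eq[OF n] show ?thesis by blast
    qed (use eq n \<open>m \<in> S\<close> in blast)
  qed
  then have "card S \<le> card {n, s1 n, s2 n, s3 n}"
    by (intro card_mono) auto
  also have "\<dots> \<le> 4"
    using card_length[of "[n, s1 n, s2 n, s3 n]"] by simp
  finally show False using card_S by simp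
qed

end

section \<open>Multiplicative relations between the bad points\<close>

context finite_flip_orbit
begin

lemma x_bad_unique:
  assumes "m \<in> S" "x m \<notin> two_cos_pi_rat"
  shows "y m \<in> two_cos_pi_rat" "z m \<in> two_cos_pi_rat"
  using finite_flip_orbit.z_bad_unique[OF finite_flip_orbit_rotate assms] by auto

lemma y_bad_unique:
  assumes "m \<in> S" "y m \<notin> two_cos_pi_rat"
  shows "z m \<in> two_cos_pi_rat" "x m \<in> two_cos_pi_rat"
  using finite_flip_orbit.z_bad_unique
    [OF finite_flip_orbit.finite_flip_orbit_rotate[OF finite_flip_orbit_rotate] assms] by auto

text \<open>\<open>prod_cycles_pole\<close> is applied to \<open>h\<close> along
  \<open>s1 \<circ> s3\<close>, which preserves \<open>y\<close>, and to \<open>h / l\<close> along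
  \<open>s2 \<circ> s3\<close>, which preserves \<open>x\<close>. In the quotient of the two
  relations \<open>h\<close> cancels, and each point other than \<open>p\<close> and
  \<open>q\<close> leaves one factor \<open>l\<close>.\<close>

lemma bad_relation_z:
  assumes p: "p \<in> S" "z p \<notin> two_cos_pi_rat"
  obtains E :: "'a \<Rightarrow> int" where "\<And>m. \<bar>E m\<bar> \<le> 1"
    "root_of_unity (mult_at p ^ (card S - 2) * (\<Prod>m\<in>bad - {p}. mult_at m powi E m))"
proof -
  define l where "l = eig (z p)"
  have l: "l \<noteq> 0" "z p = l + inverse l"
    by (simp_all add: l_def eig_add_inverse)
  have l_inverse: "l * (inverse l * t) = t" for t
    using l(1) by simp
  define q where "q = s3 p"
  have q: "q \<in> S" "s3 q = p" "q \<noteq> p" "x q = x p" "y q = y p"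
    using p closed involution z_bad_unique s3 by (auto simp: q_def)
  have s3_ne_p: "s3 m \<noteq> p" if "m \<in> S" "m \<noteq> q" for m
    using that involution(3)[of m] by (auto simp: q_def)
  have fix_p: "s1 p = p" "s2 p = p"
    using z_bad_fixed p by auto
  \<comment> \<open>Being fixed by \<open>s1\<close> and \<open>s2\<close> means that the partial
    derivatives of the cubic in \<open>x\<close> and \<open>y\<close> vanish at \<open>p\<close>.
    This removes the linear terms in \<open>factor\<close>.\<close>
  have \<theta>1: "\<theta>1 = 2 * x p + y p * z p"
    using s1(1)[OF p(1)] fix_p(1) by (simp add: algebra_simps)
  have \<theta>2: "\<theta>2 = 2 * y p + z p * x p"
    using s2(1)[OF p(1)] fix_p(2) by (simp add: algebra_simps)
  define u where "u m = x m - x p" for m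
  define v where "v m = y m - y p" for m
  define w where "w m = z m - z p" for m
  \<comment> \<open>\<open>u + l * v = w = 0\<close> is one of the two lines through \<open>p\<close>. By \<open>factor\<close> below, the other zeros
    of \<open>u + l * v\<close> are flips of this line under \<open>s3\<close>, so \<open>h\<close> has no zero or pole on the
    orbit apart from \<open>p\<close> and \<open>q\<close>.\<close>
  define h where "h m = (u m + l * v m) / w m" for m
  have xyz: "x m = x p + u m" "y m = y p + v m" "z m = z p + w m" for m
    by (simp_all add: u_def v_def w_def)
  have w_nonzero: "w m \<noteq> 0" if m: "m \<in> S" "m \<noteq> p" for m
  proof
    assume "w m = 0"
    then have zm: "z m = z p" by (simp add: w_def)
    then have "s1 m = m" "s2 m = m"
      using z_bad_fixed m p by auto
    then have "2 * x m + y m * z p = 2 * x p + y p * z p" "2 * y m + z p * x m = 2 * y p + z p * x p"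
      using s1(1)[OF m(1)] s2(1)[OF m(1)] unfolding \<theta>1 \<theta>2 zm by (simp_all add: algebra_simps)
    then have uv: "2 * u m + z p * v m = 0" "2 * v m + z p * u m = 0"
      by (simp_all add: u_def v_def algebra_simps)
    \<comment> \<open>Cramer's rule: the homogeneous system \<open>uv\<close> has determinant
      \<open>4 - z p ^ 2\<close>, which is nonzero since 2 and -2 are not bad.\<close>
    have "(2 - z p) * (2 + z p) * u m = 2 * (2 * u m + z p * v m) - z p * (2 * v m + z p * u m)"
         "(2 - z p) * (2 + z p) * v m = 2 * (2 * v m + z p * u m) - z p * (2 * u m + z p * v m)"
      by (simp_all add: algebra_simps)
    moreover have "2 - z p \<noteq> 0" "2 + z p \<noteq> 0"
      using p(2) two_in_two_cos_pi_rat two_cos_pi_rat_uminus_iff[of "z p"]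
      by (auto simp: add_eq_0_iff)
    ultimately have "u m = 0" "v m = 0"
      unfolding uv by auto
    then have "m = p"
      using m p zm by (intro ext) (auto simp: u_def v_def)
    then show False using m by simp
  qed
  \<comment> \<open>Both sides are the value of the cubic at \<open>(x m, y m, z p)\<close>: on the
    left as a quadratic form centred at \<open>p\<close>, on the right by its roots
    \<open>z m\<close> and \<open>z (s3 m)\<close> in the third variable.\<close>
  have factor: "(u m + l * v m) * (u m + inverse l * v m) = w m * w (s3 m)" if m: "m \<in> S" for m
  proof -
    have "(u m + l * v m) * (u m + inverse l * v m) = u m ^ 2 + v m ^ 2 + z p * (u m * v m)"
      using l(1) unfolding l(2) by (simp add: power2_eq_square algebra_simps)
    also have "\<dots> - w m * w (s3 m) =
        (x m * y m * z m + x m ^ 2 + y m ^ 2 + z m ^ 2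
          - \<theta>1 * x m - \<theta>2 * y m - \<theta>3 * z m + \<theta>4)
      - (x p * y p * z p + x p ^ 2 + y p ^ 2 + z p ^ 2
          - \<theta>1 * x p - \<theta>2 * y p - \<theta>3 * z p + \<theta>4)"
      unfolding \<theta>1 \<theta>2 w_def s3(1)[OF m] u_def v_def
      by (simp add: power2_eq_square algebra_simps)
    also have "\<dots> = 0"
      using surface m p(1) by simp
    finally show ?thesis by simp
  qed
  have h_nonzero: "h m \<noteq> 0" if m: "m \<in> S - {p, q}" for m
  proof -
    have "w m * w (s3 m) \<noteq> 0"
      using w_nonzero[of m] w_nonzero[of "s3 m"] s3_ne_p closed m by simp
    then show ?thesis
      using factor[of m] m by (auto simp: h_def)
  qed
  have inverse_h: "(u m + inverse l * v m) / w (s3 m) = inverse (h m)" if m: "m \<in> S - {p, q}" for m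
  proof -
    have "h m \<noteq> 0" using h_nonzero m by blast
    then have "u m + l * v m \<noteq> 0" "w m \<noteq> 0"
      by (auto simp: h_def)
    moreover have "w (s3 m) \<noteq> 0"
      using m w_nonzero[of "s3 m"] closed s3_ne_p by simp
    ultimately show ?thesis
      using factor[of m] m unfolding h_def inverse_divide
      by (subst frac_eq_eq) (simp_all only: mult.commute Diff_iff simp_thms)
  qed
  \<comment> \<open>The flip \<open>s2\<close> interchanges the two linear forms up to a scalar and
    a multiple of \<open>w\<close>. The quotient is not yet replaced by
    \<open>inverse (h m)\<close>, so that the formula also holds at \<open>m = p\<close>, where the
    quotient is 0.\<close>
  have h2: "h (s2 (s3 m)) = - (l ^ 2) * ((u m + inverse l * v m) / w (s3 m)) - l * x m"
    if m: "m \<in> S" "w (s3 m) \<noteq> 0" for m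
  proof -
    have "y (s2 (s3 m)) = \<theta>2 - y m - z (s3 m) * x m"
      using m(1) by (simp add: s2 s3(2,3) closed)
    then have veq: "v (s2 (s3 m)) = - v m - z p * u m - x m * w (s3 m)"
      unfolding v_def u_def w_def \<theta>2 by (simp add: algebra_simps)
    have "u m + l * v (s2 (s3 m)) = - (l ^ 2) * (u m + inverse l * v m) - l * x m * w (s3 m)"
      unfolding veq by (simp add: l(2) power2_eq_square algebra_simps l_inverse)
    moreover have "u (s2 (s3 m)) = u m" "w (s2 (s3 m)) = w (s3 m)"
      using m(1) unfolding w_def u_def by (simp_all add: s2 s3(2,3) closed)
    ultimately show ?thesis
      using m(2) unfolding h_def by (simp add: diff_divide_distrib)
  qed
  have h1: "h (s1 (s3 m)) = - ((u m + inverse l * v m) / w (s3 m)) - y m"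
    if m: "m \<in> S" "w (s3 m) \<noteq> 0" for m
  proof -
    have "x (s1 (s3 m)) = \<theta>1 - x m - y m * z (s3 m)"
      using m(1) by (simp add: s1 s3(2,3) closed)
    then have ueq: "u (s1 (s3 m)) = - u m - z p * v m - y m * w (s3 m)"
      unfolding v_def u_def w_def \<theta>1 by (simp add: algebra_simps)
    have "u (s1 (s3 m)) + l * v m = - (u m + inverse l * v m) - y m * w (s3 m)"
      unfolding ueq by (simp add: l(2) algebra_simps)
    moreover have "v (s1 (s3 m)) = v m" "w (s1 (s3 m)) = w (s3 m)"
      using m(1) unfolding w_def v_def by (simp_all add: s1 s3(2,3) closed)
    ultimately show ?thesis
      using m(2) unfolding h_def by (simp add: diff_divide_distrib add_divide_distrib)
  qed
  have w3: "w (s3 m) \<noteq> 0" if "m \<in> S" "m \<noteq> q" for m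
    using that w_nonzero[of "s3 m"] closed s3_ne_p by simp
  have uv_p: "u p = 0" "v p = 0" "u q = 0" "v q = 0"
    by (simp_all add: u_def v_def q)
  have "\<exists>E :: 'a \<Rightarrow> int. (\<forall>m. \<bar>E m\<bar> \<le> 1) \<and>
    root_of_unity ((\<Prod>m\<in>S - {p, q}. h m / l) * (\<Prod>m\<in>S. eig (x m) powi E m))"
  proof (rule prod_cycles_pole[of S "s2 \<circ> s3" p q "\<lambda>m. h m / l" x])
    show "bij_betw (s2 \<circ> s3) S S" by (rule bij_betw_trans[OF bij_flips(3) bij_flips(2)])
    show "h ((s2 \<circ> s3) p) / l = - x p"
      using h2[of p] w3[of p] p q(3) l(1) by (simp add: uv_p)
    show "(s2 \<circ> s3) q = p" using q(2) fix_p(2) by simp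
    show "h q / l = 0" by (simp add: h_def uv_p)
    show "h m / l \<noteq> 0" if "m \<in> S - {p, q}" for m
      using h_nonzero[OF that] l(1) by simp
    show "x ((s2 \<circ> s3) m) = x m" if "m \<in> S" for m
      using that by (simp add: s2 s3 closed)
    fix m assume m: "m \<in> S - {p, q}"
    have scale: "(- (l ^ 2) * t - l * a) / l = - a - t * l" for a t
      using l(1) by (simp add: power2_eq_square diff_divide_distrib)
    have "h (s2 (s3 m)) / l = - x m - inverse (h m) * l"
      using m w3[of m] by (simp only: h2 inverse_h[OF m] scale Diff_iff insert_iff de_Morgan_disj simp_thms)
    then show "h ((s2 \<circ> s3) m) / l = - x m - inverse (h m / l)"
      by (simp add: field_simps)
  qed (use finite_S p(1) q(1,3) z_bad_unique[OF p] in simp_all)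
  then obtain Ea :: "'a \<Rightarrow> int" where Ea: "\<And>m. \<bar>Ea m\<bar> \<le> 1"
    "root_of_unity ((\<Prod>m\<in>S - {p, q}. h m / l) * (\<Prod>m\<in>S. eig (x m) powi Ea m))"
    by blast
  have "\<exists>E :: 'a \<Rightarrow> int. (\<forall>m. \<bar>E m\<bar> \<le> 1) \<and>
    root_of_unity (prod h (S - {p, q}) * (\<Prod>m\<in>S. eig (y m) powi E m))"
  proof (rule prod_cycles_pole[of S "s1 \<circ> s3" p q h y])
    show "bij_betw (s1 \<circ> s3) S S" by (rule bij_betw_trans[OF bij_flips(3) bij_flips(1)])
    show "h ((s1 \<circ> s3) p) = - y p"
      using h1[of p] w3[of p] p q(3) by (simp add: uv_p)
    show "h ((s1 \<circ> s3) m) = - y m - inverse (h m)" if "m \<in> S - {p, q}" for m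
      using h1[of m] w3[of m] inverse_h[OF that] that by simp
    show "(s1 \<circ> s3) q = p" using q(2) fix_p(1) by simp
    show "h q = 0" by (simp add: h_def uv_p)
    show "y ((s1 \<circ> s3) m) = y m" if "m \<in> S" for m
      using that by (simp add: s1 s3 closed)
  qed (use finite_S p(1) q(1,3) h_nonzero z_bad_unique[OF p] in simp_all)
  then obtain Eb :: "'a \<Rightarrow> int" where Eb: "\<And>m. \<bar>Eb m\<bar> \<le> 1"
    "root_of_unity (prod h (S - {p, q}) * (\<Prod>m\<in>S. eig (y m) powi Eb m))"
    by blast
  define g where "g m = eig (y m) powi Eb m / eig (x m) powi Ea m" for m
  define n where "n = card S - 2"
  have "prod h (S - {p, q}) \<noteq> 0"
    using h_nonzero finite_S by auto
  moreover have "card (S - {p, q}) = n"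
    using finite_S p q by (simp add: n_def card_Diff_subset)
  ultimately have
    "(prod h (S - {p, q}) * (\<Prod>m\<in>S. eig (y m) powi Eb m)) /
       ((\<Prod>m\<in>S - {p, q}. h m / l) * (\<Prod>m\<in>S. eig (x m) powi Ea m)) = l ^ n * prod g S"
    using l(1) by (simp add: g_def prod_dividef field_simps)
  then have main: "root_of_unity (l ^ n * prod g S)"
    using root_of_unity_divide[OF Eb(2) Ea(2)] by simp
  \<comment> \<open>At a bad point at most one of \<open>x\<close> and \<open>y\<close> is bad, and
    only that factor of \<open>g m\<close> matters modulo torsion. The minus sign comes from the
    denominator of \<open>g\<close>; where \<open>z\<close> is bad, \<open>g m\<close> is
    torsion.\<close>
  define E where "E m = (if x m \<notin> two_cos_pi_rat then - Ea m
    else if y m \<notin> two_cos_pi_rat then Eb m else 0)" for m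
  have good: "root_of_unity (eig t powi i)" if "t \<in> two_cos_pi_rat" for t i
    using that by (simp add: root_of_unity_powi root_of_unity_eig_iff)
  have g_bad: "root_of_unity (mult_at m powi E m / g m)" if mb: "m \<in> bad - {p}" for m
  proof -
    have m: "m \<in> S" using mb by (auto simp: bad_def)
    consider "x m \<notin> two_cos_pi_rat" | "y m \<notin> two_cos_pi_rat"
      | "z m \<notin> two_cos_pi_rat" using mb by (auto simp: bad_def)
    then show ?thesis
    proof cases
      case 1
      have "mult_at m powi E m / g m = eig (z m) powi E m * eig (y m) powi E m / eig (y m) powi Eb m"
        using 1 by (simp add: E_def mult_at_def g_def power_int_mult_distrib power_int_minus field_simps)
      then show ?thesis
        using good x_bad_unique[OF m 1] by (simp add: root_of_unity_mult root_of_unity_divide)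
    next
      case 2
      then have "mult_at m powi E m / g m = eig (z m) powi E m * eig (x m) powi E m * eig (x m) powi Ea m"
        using y_bad_unique[OF m 2]
        by (simp add: E_def mult_at_def g_def power_int_mult_distrib field_simps)
      then show ?thesis
        using good y_bad_unique[OF m 2] by (simp add: root_of_unity_mult)
    next
      case 3
      then have "mult_at m powi E m / g m = eig (x m) powi Ea m / eig (y m) powi Eb m"
        using z_bad_unique[OF m 3] by (simp add: E_def g_def)
      then show ?thesis
        using good z_bad_unique[OF m 3] by (simp add: root_of_unity_divide)
    qed
  qed
  have g_good: "root_of_unity (g m)" if m: "m \<in> S - (bad - {p})" for m
  proof -
    have "x m \<in> two_cos_pi_rat" "y m \<in> two_cos_pi_rat"
      using m z_bad_unique[OF p] by (auto simp: bad_def)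
    then show ?thesis using good by (simp add: g_def root_of_unity_divide)
  qed
  have lp: "root_of_unity (mult_at p / l)"
    using z_bad_unique[OF p] l(1) by (simp add: mult_at_def l_def root_of_unity_mult root_of_unity_eig_iff)
  have nz: "prod g (bad - {p}) \<noteq> 0" "prod g (S - (bad - {p})) \<noteq> 0"
    using finite_S by (auto simp: g_def bad_def)
  have "prod g S = prod g (S - (bad - {p})) * prod g (bad - {p})"
    using finite_S by (intro prod.subset_diff) (auto simp: bad_def)
  \<comment> \<open>Replaces \<open>l\<close> by \<open>mult_at p\<close> and each
    \<open>g m\<close> by a power of \<open>mult_at m\<close>; all correction factors are
    torsion.\<close>
  then have "mult_at p ^ n * (\<Prod>m\<in>bad - {p}. mult_at m powi E m) =
      (l ^ n * prod g S) * (mult_at p / l) ^ n * (\<Prod>m\<in>bad - {p}. mult_at m powi E m / g m)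
        / prod g (S - (bad - {p}))"
    using nz l(1) by (simp add: prod_dividef power_divide)
  moreover have "root_of_unity \<dots>"
    by (intro root_of_unity_divide root_of_unity_mult main root_of_unity_power lp
        root_of_unity_prod g_bad g_good)
  ultimately show ?thesis
    using that[of E] Ea(1) Eb(1) by (auto simp: E_def n_def)
qed

lemma bad_relation:
  assumes "p \<in> bad"
  obtains E :: "'a \<Rightarrow> int" where "\<And>m. \<bar>E m\<bar> \<le> 1"
    "root_of_unity (mult_at p ^ (card S - 2) * (\<Prod>m\<in>bad - {p}. mult_at m powi E m))"
proof -
  interpret r: finite_flip_orbit S s2 s3 s1 y z x \<theta>2 \<theta>3 \<theta>1 \<theta>4
    by (rule finite_flip_orbit_rotate)
  interpret rr: finite_flip_orbit S s3 s1 s2 z x y \<theta>3 \<theta>1 \<theta>2 \<theta>4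
    by (rule r.finite_flip_orbit_rotate)
  have [simp]: "r.bad = bad" "rr.bad = bad"
    by (auto simp: bad_def r.bad_def rr.bad_def)
  have [simp]: "r.mult_at = mult_at" "rr.mult_at = mult_at"
    by (simp_all add: fun_eq_iff mult_at_def r.mult_at_def rr.mult_at_def mult_ac)
  have p: "p \<in> S" using assms by (simp add: bad_def)
  from assms consider "z p \<notin> two_cos_pi_rat" | "x p \<notin> two_cos_pi_rat" | "y p \<notin> two_cos_pi_rat"
    unfolding bad_def by blast
  then show ?thesis
  proof cases
    case 1
    then show ?thesis using bad_relation_z[OF p] that by blast
  next
    case 2
    then show ?thesis using r.bad_relation_z[OF p] that by auto
  next
    case 3
    then show ?thesis using rr.bad_relation_z[OF p] that by auto
  qed
qed

text \<open>In the matrix of exponents each diagonal entry is \<open>card S - 2\<close>, while the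
  off-diagonal entries of a row have absolute sum at most \<open>card bad - 1\<close>, which is
  smaller by \<open>card_bad\<close>. So \<open>mult_at p\<close> would be torsion, although exactly
  one of its three factors is not.\<close>

lemma bad_empty: "bad = {}"
proof (rule ccontr)
  assume "bad \<noteq> {}"
  then obtain p where p: "p \<in> bad" by blast
  have fin: "finite bad"
    using finite_S by (simp add: bad_def)
  have "\<forall>p\<in>bad. \<exists>E::'a \<Rightarrow> int. (\<forall>m. \<bar>E m\<bar> \<le> 1) \<and>
      root_of_unity (mult_at p ^ (card S - 2) * (\<Prod>m\<in>bad - {p}. mult_at m powi E m))"
    using bad_relation by metis
  then obtain E :: "'a \<Rightarrow> 'a \<Rightarrow> int" where E: "\<And>p m. p \<in> bad \<Longrightarrow> \<bar>E p m\<bar> \<le> 1"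
    "\<And>p. p \<in> bad \<Longrightarrow>
      root_of_unity (mult_at p ^ (card S - 2) * (\<Prod>m\<in>bad - {p}. mult_at m powi E p m))"
    unfolding bchoice_iff by blast
  define A where "A p m = (if m = p then int (card S - 2) else E p m)" for p m
  have unit: "root_of_unity (mult_at p)"
  proof (rule root_of_unity_diag_dominant[OF fin, where A = A])
    fix p assume p: "p \<in> bad"
    show "mult_at p \<noteq> 0" by (simp add: mult_at_def)
    have "(\<Sum>m\<in>bad - {p}. \<bar>A p m\<bar>) \<le> (\<Sum>m\<in>bad - {p}. 1)"
      using E(1)[OF p] by (intro sum_mono) (auto simp: A_def)
    also have "\<dots> < A p p"
      using card_bad p fin card_gt_0_iff[of bad] by (auto simp: A_def)
    finally show "(\<Sum>m\<in>bad - {p}. \<bar>A p m\<bar>) < A p p" .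
    have "(\<Prod>m\<in>bad. mult_at m powi A p m)
        = mult_at p powi A p p * (\<Prod>m\<in>bad - {p}. mult_at m powi A p m)"
      using p fin by (rule prod.remove[rotated])
    also have "(\<Prod>m\<in>bad - {p}. mult_at m powi A p m) = (\<Prod>m\<in>bad - {p}. mult_at m powi E p m)"
      by (rule prod.cong) (auto simp: A_def)
    also have "mult_at p powi A p p = mult_at p ^ (card S - 2)"
      by (simp add: A_def)
    finally show "root_of_unity (\<Prod>m\<in>bad. mult_at m powi A p m)"
      using E(2)[OF p] by simp
  qed (rule p)
  have pS: "p \<in> S" using p by (simp add: bad_def)
  note good = root_of_unity_eig_iff[THEN iffD2]
  from p consider "x p \<notin> two_cos_pi_rat" | "y p \<notin> two_cos_pi_rat" | "z p \<notin> two_cos_pi_rat"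
    unfolding bad_def by blast
  then show False
  proof cases
    case 1
    have "root_of_unity (mult_at p / eig (y p) / eig (z p))"
      by (intro root_of_unity_divide unit good x_bad_unique[OF pS 1])
    then show False using 1 by (simp add: mult_at_def root_of_unity_eig_iff)
  next
    case 2
    have "root_of_unity (mult_at p / eig (x p) / eig (z p))"
      by (intro root_of_unity_divide unit good y_bad_unique[OF pS 2])
    then show False using 2 by (simp add: mult_at_def root_of_unity_eig_iff)
  next
    case 3
    have "root_of_unity (mult_at p / eig (x p) / eig (y p))"
      by (intro root_of_unity_divide unit good z_bad_unique[OF pS 3])
    then show False using 3 by (simp add: mult_at_def root_of_unity_eig_iff)
  qed
qed

end

section \<open>Orbits under words of even length\<close>

context flip_system
begin

text \<open>Words act by plain function application, which keeps the group structure out of the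
  argument until the final transfer.\<close>

definition even_orbit :: "'a \<Rightarrow> 'a set" where
  "even_orbit m = {foldr (\<lambda>f. f) fs m | fs. set fs \<subseteq> {s1, s2, s3} \<and> even (length fs)}"

lemma word_in_S: "set fs \<subseteq> {s1, s2, s3} \<Longrightarrow> m \<in> S \<Longrightarrow> foldr (\<lambda>f. f) fs m \<in> S"
  by (induction fs) (auto simp: closed)

lemma word_rev:
  "set fs \<subseteq> {s1, s2, s3} \<Longrightarrow> m \<in> S \<Longrightarrow> foldr (\<lambda>f. f) (rev fs) (foldr (\<lambda>f. f) fs m) = m"
proof (induction fs)
  case (Cons f fs)
  have "f (f n) = n" if "n \<in> S" for n
    using Cons.prems that involution by auto
  then show ?case using Cons word_in_S[of fs m] by simp
qed simp

lemma even_orbit_subset: "m \<in> S \<Longrightarrow> even_orbit m \<subseteq> S"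
  using word_in_S by (auto simp: even_orbit_def)

lemma self_in_even_orbit: "m \<in> even_orbit m"
  unfolding even_orbit_def by (intro CollectI exI[of _ "[]"]) simp

lemma even_orbit_word:
  assumes "n \<in> even_orbit m" "set fs \<subseteq> {s1, s2, s3}" "even (length fs)"
  shows "foldr (\<lambda>f. f) fs n \<in> even_orbit m"
proof -
  obtain gs where "n = foldr (\<lambda>f. f) gs m" "set gs \<subseteq> {s1, s2, s3}" "even (length gs)"
    using assms(1) by (auto simp: even_orbit_def)
  then show ?thesis
    using assms(2,3) unfolding even_orbit_def by (intro CollectI exI[of _ "fs @ gs"]) simp
qed

lemma even_orbit_pair:
  "n \<in> even_orbit m \<Longrightarrow> f \<in> {s1, s2, s3} \<Longrightarrow> g \<in> {s1, s2, s3} \<Longrightarrow> f (g n) \<in> even_orbit m"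
  using even_orbit_word[of n m "[f, g]"] by simp

lemma even_orbit_eq:
  assumes "m \<in> S" "n \<in> even_orbit m"
  shows "even_orbit n = even_orbit m"
proof
  show "even_orbit n \<subseteq> even_orbit m"
    using even_orbit_word[OF assms(2)] by (auto simp: even_orbit_def[of n])
  obtain gs where gs: "n = foldr (\<lambda>f. f) gs m" "set gs \<subseteq> {s1, s2, s3}" "even (length gs)"
    using assms(2) by (auto simp: even_orbit_def)
  have "m = foldr (\<lambda>f. f) (rev gs) n"
    using word_rev[OF gs(2) assms(1)] gs(1) by simp
  then have "m \<in> even_orbit n"
    using gs unfolding even_orbit_def by (intro CollectI exI[of _ "rev gs"]) simp
  then show "even_orbit m \<subseteq> even_orbit n"
    using even_orbit_word[of m n] by (auto simp: even_orbit_def[of m])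
qed

lemma even_orbit_subset_closed:
  assumes "m \<in> A" "\<And>n. n \<in> A \<Longrightarrow> s1 n \<in> A \<and> s2 n \<in> A \<and> s3 n \<in> A"
  shows "even_orbit m \<subseteq> A"
proof -
  have "foldr (\<lambda>f. f) fs m \<in> A" if "set fs \<subseteq> {s1, s2, s3}" for fs
    using that assms by (induction fs) auto
  then show ?thesis by (auto simp: even_orbit_def)
qed

text \<open>A flip fixing \<open>p\<close> can be inserted at the start of a word applied to
  \<open>p\<close> to correct its parity, so even and odd words reach the same points.\<close>

lemma even_orbit_closed_if_fixed:
  assumes m: "m \<in> S" and p: "p \<in> even_orbit m" "f \<in> {s1, s2, s3}" "f p = p"
    and n: "n \<in> even_orbit m" "g \<in> {s1, s2, s3}"
  shows "g n \<in> even_orbit m"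
proof -
  have "n \<in> even_orbit p" using even_orbit_eq[OF m p(1)] n(1) by simp
  then obtain gs where gs: "n = foldr (\<lambda>f. f) gs p" "set gs \<subseteq> {s1, s2, s3}" "even (length gs)"
    by (auto simp: even_orbit_def)
  have "foldr (\<lambda>f. f) (g # gs @ [f]) p \<in> even_orbit m"
    using gs p(2) n(2) by (intro even_orbit_word[OF p(1)]) auto
  then show ?thesis using gs(1) p(3) by simp
qed

lemma flip_system_subset:
  assumes "A \<subseteq> S" "\<And>n. n \<in> A \<Longrightarrow> s1 n \<in> A \<and> s2 n \<in> A \<and> s3 n \<in> A"
  shows "flip_system A s1 s2 s3 x y z \<theta>1 \<theta>2 \<theta>3 \<theta>4"
  by unfold_locales (use assms s1 s2 s3 surface in \<open>auto intro: ext\<close>)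

lemma finite_flip_orbit_even_orbit:
  assumes m: "m \<in> S" and fin: "finite (even_orbit m)" "card (even_orbit m) \<ge> 5"
    and p: "p \<in> even_orbit m" "f \<in> {s1, s2, s3}" "f p = p"
  shows "finite_flip_orbit (even_orbit m) s1 s2 s3 x y z \<theta>1 \<theta>2 \<theta>3 \<theta>4"
proof (intro finite_flip_orbit.intro finite_flip_orbit_axioms.intro flip_system_subset)
  show "s1 n \<in> even_orbit m \<and> s2 n \<in> even_orbit m \<and> s3 n \<in> even_orbit m" if "n \<in> even_orbit m" for n
    using even_orbit_closed_if_fixed[OF m p that] by simp
  fix A assume A: "A \<subseteq> even_orbit m" "A \<noteq> {}"
    "\<And>m. m \<in> A \<Longrightarrow> s1 m \<in> A \<and> s2 m \<in> A \<and> s3 m \<in> A"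
  then obtain a where a: "a \<in> A" by blast
  have "even_orbit m = even_orbit a"
    using even_orbit_eq[OF m, of a] a A(1) by auto
  also have "\<dots> \<subseteq> A" using a A(3) by (rule even_orbit_subset_closed)
  finally show "A = even_orbit m" using A(1) by auto
qed (use fin even_orbit_subset[OF m] in auto)

text \<open>The even word \<open>s1 \<circ> s2\<close> permutes the finite even orbit, so a point
  with bad \<open>z\<close> is fixed by \<open>s1\<close>. The even orbit is then invariant under
  all flips, and \<open>bad_empty\<close> applies to it.\<close>

lemma finite_even_orbit_z:
  assumes m: "m \<in> S" and fin: "finite (even_orbit m)" "card (even_orbit m) \<ge> 5"
    and p: "p \<in> even_orbit m"
  shows "z p \<in> two_cos_pi_rat"
proof (rule ccontr)
  assume bad: "z p \<notin> two_cos_pi_rat"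
  let ?O = "even_orbit m"
  have OS: "?O \<subseteq> S" by (rule even_orbit_subset[OF m])
  have "bij_betw (s1 \<circ> s2) ?O ?O"
    by (rule bij_betw_byWitness[where f' = "s2 \<circ> s1"])
      (use OS in \<open>auto simp: subset_iff closed involution intro: even_orbit_pair\<close>)
  then obtain N where "N > 0" "\<And>n. n \<in> ?O \<Longrightarrow> ((s1 \<circ> s2) ^^ N) n = n"
    using ex_common_period[OF fin(1)] by blast
  then have "s1 p = p"
    using fixed_if_periodic[of p N] p OS bad by blast
  then interpret O: finite_flip_orbit ?O s1 s2 s3 x y z \<theta>1 \<theta>2 \<theta>3 \<theta>4
    using finite_flip_orbit_even_orbit[OF m fin p, of s1] by simp
  have "p \<in> O.bad" using p bad by (simp add: O.bad_def)
  then show False using O.bad_empty by simp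
qed

lemma finite_even_orbit_good:
  assumes m: "m \<in> S" and fin: "finite (even_orbit m)" "card (even_orbit m) \<ge> 5"
    and p: "p \<in> even_orbit m"
  shows "x p \<in> two_cos_pi_rat" "y p \<in> two_cos_pi_rat" "z p \<in> two_cos_pi_rat"
proof -
  interpret r: flip_system S s2 s3 s1 y z x \<theta>2 \<theta>3 \<theta>1 \<theta>4
    by (rule flip_system_rotate)
  interpret rr: flip_system S s3 s1 s2 z x y \<theta>3 \<theta>1 \<theta>2 \<theta>4
    by (rule r.flip_system_rotate)
  have 1: "r.even_orbit = even_orbit" "rr.even_orbit = even_orbit"
    by (simp_all add: even_orbit_def r.even_orbit_def rr.even_orbit_def fun_eq_iff insert_commute)
  show "x p \<in> two_cos_pi_rat" "y p \<in> two_cos_pi_rat" "z p \<in> two_cos_pi_rat"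
    using r.finite_even_orbit_z[of m p] rr.finite_even_orbit_z[of m p] finite_even_orbit_z[of m p] assms
    unfolding 1 by blast+
qed

text \<open>The point \<open>s1 n\<close> itself may lie outside the even orbit, but
  \<open>s2 (s1 n)\<close> lies in it and has the same \<open>x\<close>; similarly for the other
  coordinates.\<close>

lemma flip_coordinates_good:
  assumes m: "m \<in> S" and n: "n \<in> even_orbit m"
    and good: "\<And>p. p \<in> even_orbit m \<Longrightarrow>
      x p \<in> two_cos_pi_rat \<and> y p \<in> two_cos_pi_rat \<and> z p \<in> two_cos_pi_rat"
  shows "x (s1 n) \<in> two_cos_pi_rat" "y (s2 n) \<in> two_cos_pi_rat" "z (s3 n) \<in> two_cos_pi_rat"
proof -
  have "n \<in> S" using n even_orbit_subset[OF m] by blast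
  then show "x (s1 n) \<in> two_cos_pi_rat" "y (s2 n) \<in> two_cos_pi_rat" "z (s3 n) \<in> two_cos_pi_rat"
    using good[OF even_orbit_pair[OF n, of s2 s1]] good[OF even_orbit_pair[OF n, of s3 s2]]
      good[OF even_orbit_pair[OF n, of s1 s3]]
    by (auto simp: s1 s2 s3 closed)
qed

lemma \<theta>4_eq:
  assumes "m \<in> S"
  shows "\<theta>4 = x m * x (s1 m) + y m * y (s2 m) + z m * z (s3 m) + 2 * (x m * y m * z m)"
  using surface[OF assms] assms by (simp add: s1 s2 s3 power2_eq_square algebra_simps)

lemma card_le_4_if_coordinates:
  assumes "A \<subseteq> S" "finite T" "card T \<le> 4" "\<And>n. n \<in> A \<Longrightarrow> (x n, y n, z n) \<in> T"
  shows "card A \<le> 4"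
proof -
  have "inj_on (\<lambda>n. (x n, y n, z n)) A"
    using assms(1) by (intro inj_onI) (auto intro: ext)
  moreover have "(\<lambda>n. (x n, y n, z n)) ` A \<subseteq> T" using assms(4) by auto
  ultimately have "card A \<le> card T" using assms(2) by (intro card_inj_on_le)
  then show ?thesis using assms(3) by simp
qed

end

section \<open>Bounds on the parameters\<close>

lemma two_cos_pi_rat_real:
  assumes "w \<in> two_cos_pi_rat"
  shows "w = of_real (Re w)" "\<bar>Re w\<bar> \<le> 2"
  using assms by (auto simp: two_cos_pi_rat_def abs_mult)

lemma abs_eq_2_if_mult_eq_4:
  fixes a b :: real
  assumes "\<bar>a\<bar> \<le> 2" "\<bar>b\<bar> \<le> 2" "\<bar>a * b\<bar> \<ge> 4"
  shows "\<bar>a\<bar> = 2" "\<bar>b\<bar> = 2"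
proof -
  have "\<bar>a\<bar> * \<bar>b\<bar> \<le> \<bar>a\<bar> * 2" "\<bar>a\<bar> * \<bar>b\<bar> \<le> 2 * \<bar>b\<bar>"
    using assms by (auto intro: mult_left_mono mult_right_mono)
  then show "\<bar>a\<bar> = 2" "\<bar>b\<bar> = 2"
    using assms by (auto simp: abs_mult)
qed

lemma abs_mult_le_4:
  fixes a b :: real
  assumes "\<bar>a\<bar> \<le> 2" "\<bar>b\<bar> \<le> 2"
  shows "\<bar>a * b\<bar> \<le> 4"
  using mult_mono[OF assms] by (simp add: abs_mult)

context flip_system
begin

context
  fixes m
  assumes m: "m \<in> S" and card: "card (even_orbit m) \<ge> 5"
    and good: "\<And>p. p \<in> even_orbit m \<Longrightarrow>
      x p \<in> two_cos_pi_rat \<and> y p \<in> two_cos_pi_rat \<and> z p \<in> two_cos_pi_rat"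
begin

lemma \<theta>1_bounds: "- 8 < Re \<theta>1" "Re \<theta>1 < 8"
proof -
  have *: "\<bar>Re \<theta>1\<bar> < 8"
  proof (rule ccontr)
    assume "\<not> ?thesis"
    then have large: "\<bar>Re \<theta>1\<bar> \<ge> 8" by simp
    define s where "s = sgn (Re \<theta>1)"
    \<comment> \<open>The estimate \<open>2 + 2 + 4\<close> would be attained at every point of the
      orbit, so \<open>x\<close> is constant and \<open>y\<close>, \<open>z\<close> are 2 or
      -2.\<close>
    have "(x n, y n, z n) \<in> {of_real (2 * s)} \<times> {2, - 2} \<times> {2, - 2}" if n: "n \<in> even_orbit m" for n
    proof -
      have g: "x n \<in> two_cos_pi_rat" "y n \<in> two_cos_pi_rat" "z n \<in> two_cos_pi_rat"
        "x (s1 n) \<in> two_cos_pi_rat"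
        using good[OF n] flip_coordinates_good(1)[OF m n good] by auto
      note r = two_cos_pi_rat_real[OF g(1)] two_cos_pi_rat_real[OF g(2)]
        two_cos_pi_rat_real[OF g(3)] two_cos_pi_rat_real[OF g(4)]
      have "\<theta>1 = x n + x (s1 n) + y n * z n"
        using n even_orbit_subset[OF m] s1(1)[of n] by auto
      also have "Re \<dots> = Re (x n) + Re (x (s1 n)) + Re (y n) * Re (z n)"
        using r(3,5) by (metis Re_complex_of_real of_real_mult plus_complex.sel(1))
      finally have eq: "Re \<theta>1 = Re (x n) + Re (x (s1 n)) + Re (y n) * Re (z n)" .
      have yz: "\<bar>Re (y n) * Re (z n)\<bar> \<le> 4"
        using r by (intro abs_mult_le_4)
      have "Re (x n) = 2 * s" "\<bar>Re (y n) * Re (z n)\<bar> \<ge> 4"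
        using large eq yz r(2,4,6,8) unfolding s_def by (auto simp: sgn_if)
      then have "Re (x n) = 2 * s" "Re (y n) \<in> {2, - 2}" "Re (z n) \<in> {2, - 2}"
        using abs_eq_2_if_mult_eq_4[of "Re (y n)" "Re (z n)"] r(4,6) by auto
      then show ?thesis
        using r(1,3,5) by (auto simp: complex_eq_iff)
    qed
    then have "card (even_orbit m) \<le> 4"
      by (rule card_le_4_if_coordinates[OF even_orbit_subset[OF m], rotated -1]) auto
    then show False using card by simp
  qed
  then show "- 8 < Re \<theta>1" "Re \<theta>1 < 8" by auto
qed

lemma \<theta>4_bounds: "- 28 < Re \<theta>4" "Re \<theta>4 < 28"
proof -
  have *: "\<bar>Re \<theta>4\<bar> < 28"
  proof (rule ccontr)
    assume "\<not> ?thesis"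
    then have large: "\<bar>Re \<theta>4\<bar> \<ge> 28" by simp
    define s :: complex where "s = of_real (2 * sgn (Re \<theta>4))"
    \<comment> \<open>The estimate \<open>4 + 4 + 4 + 16\<close> would be attained, so
      \<open>x * y * z\<close> is 8 times the sign of \<open>Re \<theta>4\<close>, and the signs of
      \<open>y\<close> and \<open>z\<close> determine \<open>x\<close>.\<close>
    have "(x n, y n, z n) \<in> {(s, 2, 2), (s, - 2, - 2), (- s, 2, - 2), (- s, - 2, 2)}"
      if n: "n \<in> even_orbit m" for n
    proof -
      have nS: "n \<in> S" using n even_orbit_subset[OF m] by auto
      define a b c a' b' c' where "a = Re (x n)" and "b = Re (y n)" and "c = Re (z n)"
        and "a' = Re (x (s1 n))" and "b' = Re (y (s2 n))" and "c' = Re (z (s3 n))"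
      note defs = a_def b_def c_def a'_def b'_def c'_def
      have r: "x n = of_real a" "y n = of_real b" "z n = of_real c"
        "x (s1 n) = of_real a'" "y (s2 n) = of_real b'" "z (s3 n) = of_real c'"
        and le: "\<bar>a\<bar> \<le> 2" "\<bar>b\<bar> \<le> 2" "\<bar>c\<bar> \<le> 2" "\<bar>a'\<bar> \<le> 2" "\<bar>b'\<bar> \<le> 2" "\<bar>c'\<bar> \<le> 2"
        using two_cos_pi_rat_real good[OF n] flip_coordinates_good[OF m n good] unfolding defs by blast+
      have eq: "Re \<theta>4 = a * a' + b * b' + c * c' + 2 * (a * b * c)"
        using arg_cong[OF \<theta>4_eq[OF nS], of Re] by (simp add: r)
      have le4: "\<bar>a * a'\<bar> \<le> 4" "\<bar>b * b'\<bar> \<le> 4" "\<bar>c * c'\<bar> \<le> 4" "\<bar>b * c\<bar> \<le> 4"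
        using le by (auto intro: abs_mult_le_4)
      have "\<bar>a * (b * c)\<bar> \<le> 2 * 4"
        using mult_mono[OF le(1) le4(4)] by (simp add: abs_mult)
      then have abc: "a * (b * c) = 8 * sgn (Re \<theta>4)" "sgn (Re \<theta>4) \<noteq> 0"
        using large eq le4 by (auto simp: sgn_if mult.assoc)
      then have "\<bar>a\<bar> * \<bar>b * c\<bar> = 8" by (simp add: sgn_if flip: abs_mult split: if_splits)
      moreover have "\<bar>a\<bar> * \<bar>b * c\<bar> \<le> 2 * \<bar>b * c\<bar>"
        using le(1) by (intro mult_right_mono) auto
      ultimately have "\<bar>b * c\<bar> \<ge> 4" by simp
      then have "\<bar>b\<bar> = 2" "\<bar>c\<bar> = 2"
        using abs_eq_2_if_mult_eq_4 le by blast+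
      then consider "b = 2" "c = 2" | "b = 2" "c = - 2" | "b = - 2" "c = 2" | "b = - 2" "c = - 2"
        by linarith
      then show ?thesis
        using abc(1) unfolding r s_def by cases (auto simp: complex_eq_iff)
    qed
    then have "card (even_orbit m) \<le> 4"
      by (rule card_le_4_if_coordinates[OF even_orbit_subset[OF m], rotated -1])
        (auto simp: card_insert_if)
    then show False using card by simp
  qed
  then show "- 28 < Re \<theta>4" "Re \<theta>4 < 28" by auto
qed

end

end

section \<open>Rings generated by a root of unity\<close>

lemma cyclotomic_field_closed:
  shows "cis (2 * pi / real n) \<in> cyclotomic_field n"
    and "of_int i \<in> cyclotomic_field n"
    and "a \<in> cyclotomic_field n \<Longrightarrow> b \<in> cyclotomic_field n \<Longrightarrow> a + b \<in> cyclotomic_field n"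
    and "a \<in> cyclotomic_field n \<Longrightarrow> b \<in> cyclotomic_field n \<Longrightarrow> a * b \<in> cyclotomic_field n"
proof -
  let ?K = "cyclotomic_field n"
  let ?R = "ring_of_type_algebra :: complex ring"
  interpret R: ring ?R by (rule ring_from_type_algebra)
  have R: "carrier ?R = UNIV" "\<one>\<^bsub>?R\<^esub> = 1" "\<zero>\<^bsub>?R\<^esub> = 0"
    "a \<oplus>\<^bsub>?R\<^esub> b = a + b" "a \<otimes>\<^bsub>?R\<^esub> b = a * b" for a b
    by (simp_all add: ring_of_type_algebra_def)
  have neg_eq: "\<ominus>\<^bsub>?R\<^esub> a = - a" for a
    by (rule R.minus_equality) (simp_all add: R)
  show "cis (2 * pi / real n) \<in> ?K"
    unfolding cyclotomic_field_def by (rule generate_field.incl) simp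
  have one: "1 \<in> ?K"
    using generate_field.one[of ?R "{cis (2 * pi / real n)}"] by (simp only: cyclotomic_field_def R)
  have neg: "- a \<in> ?K" if "a \<in> ?K" for a
    using generate_field.a_inv[OF that[unfolded cyclotomic_field_def]]
    by (simp only: cyclotomic_field_def neg_eq)
  have plus: "a + b \<in> ?K" if "a \<in> ?K" "b \<in> ?K" for a b
    using generate_field.eng_add[OF that[unfolded cyclotomic_field_def]]
    by (simp only: cyclotomic_field_def R)
  then show "a \<in> ?K \<Longrightarrow> b \<in> ?K \<Longrightarrow> a + b \<in> ?K" .
  have times: "a * b \<in> ?K" if "a \<in> ?K" "b \<in> ?K" for a b
    using generate_field.eng_mult[OF that[unfolded cyclotomic_field_def]]
    by (simp only: cyclotomic_field_def R)
  then show "a \<in> ?K \<Longrightarrow> b \<in> ?K \<Longrightarrow> a * b \<in> ?K" .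
  have "0 \<in> ?K" using plus[OF one neg[OF one]] by simp
  then have nat: "of_nat k \<in> ?K" for k
    by (induction k) (use one plus in auto)
  show "of_int i \<in> ?K"
  proof (cases i)
    case (nonneg k)
    then show ?thesis using nat[of k] by simp
  next
    case (neg k)
    then show ?thesis using \<open>\<And>a. a \<in> ?K \<Longrightarrow> - a \<in> ?K\<close>[OF nat[of "Suc k"]] by simp
  qed
qed

definition int_eval :: "int poly \<Rightarrow> complex \<Rightarrow> complex" where
  "int_eval p w = poly (map_poly of_int p) w"

lemma int_eval_simps [simp]:
  "int_eval 0 w = 0" "int_eval 1 w = 1"
  "int_eval (p + q) w = int_eval p w + int_eval q w"
  "int_eval (p - q) w = int_eval p w - int_eval q w"
  "int_eval (- p) w = - int_eval p w"
  "int_eval (p * q) w = int_eval p w * int_eval q w"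
  "int_eval (Polynomial.smult a p) w = of_int a * int_eval p w"
  "int_eval (pCons a p) w = of_int a + w * int_eval p w"
  "int_eval (monom a n) w = of_int a * w ^ n"
  by (simp_all add: int_eval_def hom_distribs poly_monom)

lemma int_eval_sum: "int_eval p w = (\<Sum>i\<le>Polynomial.degree p. of_int (Polynomial.coeff p i) * w ^ i)"
  by (simp add: int_eval_def poly_altdef)

definition adjoin_int :: "complex \<Rightarrow> complex set" where
  "adjoin_int w = range (\<lambda>p. int_eval p w)"

lemma adjoin_int_arith:
  assumes "a \<in> adjoin_int w" "b \<in> adjoin_int w"
  shows "a + b \<in> adjoin_int w" "a - b \<in> adjoin_int w" "a * b \<in> adjoin_int w"
proof -
  obtain p q where pq: "a = int_eval p w" "b = int_eval q w"
    using assms by (auto simp: adjoin_int_def)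
  show "a + b \<in> adjoin_int w"
    unfolding adjoin_int_def pq by (rule range_eqI[of _ _ "p + q"]) simp
  show "a - b \<in> adjoin_int w"
    unfolding adjoin_int_def pq by (rule range_eqI[of _ _ "p - q"]) simp
  show "a * b \<in> adjoin_int w"
    unfolding adjoin_int_def pq by (rule range_eqI[of _ _ "p * q"]) simp
qed

lemma power_in_adjoin_int: "w ^ n \<in> adjoin_int w"
  unfolding adjoin_int_def by (rule range_eqI[of _ _ "monom 1 n"]) simp

text \<open>Lagrange interpolation with the basis \<open>L c\<close> expresses the coefficients
  linearly in the values on \<open>V\<close>. Bounded values thus bound the coefficients, which are
  integers.\<close>

lemma finite_bounded_int_polys:
  fixes V :: "complex set"
  assumes "finite V"
  shows "finite {p. Polynomial.degree p < card V \<and> (\<forall>c\<in>V. norm (int_eval p c) \<le> B)}"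
proof -
  define D where "D = card V"
  define L where "L c = (\<Prod>a\<in>V - {c}. Polynomial.smult (inverse (c - a)) [:- a, 1:])" for c
  have L_degree: "Polynomial.degree (L c) < D" if "c \<in> V" for c
  proof -
    have "Polynomial.degree (L c) \<le> (\<Sum>a\<in>V - {c}. Polynomial.degree (Polynomial.smult (inverse (c - a)) [:- a, 1:]))"
      unfolding L_def using assms by (intro degree_prod_sum_le[unfolded o_def]) auto
    also have "\<dots> \<le> (\<Sum>a\<in>V - {c}. 1)"
      by (intro sum_mono) auto
    also have "\<dots> < D"
      using assms that card_gt_0_iff[of V] by (auto simp: D_def)
    finally show ?thesis .
  qed
  have L_eval: "poly (L c) a = (if a = c then 1 else 0)" if "a \<in> V" "c \<in> V" for a c
  proof (cases "a = c")
    case True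
    have "inverse (c - x) * c - inverse (c - x) * x = 1" if "x \<noteq> c" for x
      using that by (simp flip: right_diff_distrib)
    then show ?thesis
      using True by (auto simp: L_def poly_prod algebra_simps intro!: prod.neutral)
  qed (use assms that in \<open>auto simp: L_def poly_prod\<close>)
  define K where "K = (\<Sum>i<D. \<Sum>c\<in>V. \<bar>B\<bar> * norm (Polynomial.coeff (L c) i))"
  have interp: "map_poly of_int p = (\<Sum>c\<in>V. Polynomial.smult (int_eval p c) (L c))"
    if "Polynomial.degree p < D" for p :: "int poly"
  proof (rule poly_eqI_degree[of V])
    fix a assume a: "a \<in> V"
    have "poly (\<Sum>c\<in>V. Polynomial.smult (int_eval p c) (L c)) a = (\<Sum>c\<in>V. if a = c then int_eval p c else 0)"
      unfolding poly_sum using a by (intro sum.cong) (auto simp: L_eval)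
    then show "poly (map_poly of_int p) a = poly (\<Sum>c\<in>V. Polynomial.smult (int_eval p c) (L c)) a"
      using a assms by (simp add: int_eval_def)
  next
    show "Polynomial.degree (map_poly of_int p :: complex poly) < card V"
      using that by (simp add: D_def)
    have "Polynomial.degree (Polynomial.smult (int_eval p c) (L c)) < D" if "c \<in> V" for c
      using L_degree[OF that] degree_smult_le le_less_trans by blast
    moreover have "D > 0" using that by simp
    ultimately show "Polynomial.degree (\<Sum>c\<in>V. Polynomial.smult (int_eval p c) (L c)) < card V"
      unfolding D_def[symmetric] by (intro degree_sum_less) auto
  qed
  have bound: "\<bar>Polynomial.coeff p i\<bar> \<le> \<lceil>K\<rceil>"
    if p: "Polynomial.degree p < D" "\<forall>c\<in>V. norm (int_eval p c) \<le> B" and i: "i < D" for p i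
  proof -
    have "complex_of_int (Polynomial.coeff p i) = (\<Sum>c\<in>V. int_eval p c * Polynomial.coeff (L c) i)"
      using arg_cong[OF interp[OF p(1)], of "\<lambda>q. Polynomial.coeff q i"] by (simp add: coeff_sum)
    then have "norm (complex_of_int (Polynomial.coeff p i))
        \<le> (\<Sum>c\<in>V. norm (int_eval p c * Polynomial.coeff (L c) i))"
      by (simp only: norm_sum)
    also have "\<dots> \<le> (\<Sum>c\<in>V. \<bar>B\<bar> * norm (Polynomial.coeff (L c) i))"
      using p(2) by (intro sum_mono) (auto simp: norm_mult intro!: mult_right_mono)
    also have "\<dots> \<le> K"
      unfolding K_def using i
      by (intro member_le_sum[of i "{..<D}" "\<lambda>i. \<Sum>c\<in>V. \<bar>B\<bar> * norm (Polynomial.coeff (L c) i)"])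
        (auto intro: sum_nonneg)
    finally have "real_of_int \<bar>Polynomial.coeff p i\<bar> \<le> K" by simp
    then show ?thesis by linarith
  qed
  define F where "F = {xs. set xs \<subseteq> {- \<lceil>K\<rceil>..\<lceil>K\<rceil>} \<and> length xs = D}"
  have "finite F"
    unfolding F_def by (intro finite_lists_length_eq) simp
  moreover have "{p. Polynomial.degree p < card V \<and> (\<forall>c\<in>V. norm (int_eval p c) \<le> B)} \<subseteq> Poly ` F"
  proof
    fix p assume "p \<in> {p. Polynomial.degree p < card V \<and> (\<forall>c\<in>V. norm (int_eval p c) \<le> B)}"
    then have p: "Polynomial.degree p < D" "\<forall>c\<in>V. norm (int_eval p c) \<le> B"
      by (auto simp: D_def)
    have "p = Poly (map (Polynomial.coeff p) [0..<D])"
      using p(1) by (intro poly_eqI) (auto simp: nth_default_def coeff_eq_0)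
    moreover have "map (Polynomial.coeff p) [0..<D] \<in> F"
      using bound[OF p] unfolding F_def by (auto simp: abs_le_iff) (smt (verit))
    ultimately show "p \<in> Poly ` F" by blast
  qed
  ultimately show ?thesis
    using finite_surj by blast
qed

text \<open>The Chebyshev polynomials rescaled to \<open>2 * T_n (t / 2)\<close>. Working over any
  commutative ring allows an integer polynomial as argument.\<close>

fun cheb :: "'a :: comm_ring_1 \<Rightarrow> nat \<Rightarrow> 'a" where
  "cheb t 0 = 2"
| "cheb t (Suc 0) = t"
| "cheb t (Suc (Suc n)) = t * cheb t (Suc n) - cheb t n"

lemma cheb_add_inverse: "u \<noteq> 0 \<Longrightarrow> cheb (u + inverse u) n = u ^ n + inverse (u :: complex) ^ n"
proof (induction n rule: induct_nat_012)
  case (ge2 n)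
  have cancel: "u * (inverse u * t) = t" for t
    using ge2.prems by simp
  have "(u + inverse u) * (u ^ Suc n + inverse u ^ Suc n) - (u ^ n + inverse u ^ n)
      = u ^ Suc (Suc n) + inverse u ^ Suc (Suc n)"
    by (simp add: algebra_simps cancel)
  then show ?case using ge2 by simp
qed auto

lemma int_eval_cheb: "int_eval (cheb p n) w = cheb (int_eval p w) n"
proof (induction n rule: induct_nat_012)
  case 0
  have "int_eval 2 w = 2"
    using int_eval_simps(3)[of 1 1 w] by simp
  then show ?case by simp
qed simp_all

text \<open>With \<open>w = u + inverse u\<close> the equation reads
  \<open>u ^ n + inverse (u ^ n) = 2\<close>, which is equivalent to
  \<open>(u ^ n - 1) ^ 2 = 0\<close>.\<close>

lemma two_cos_pi_rat_cheb: "w \<in> two_cos_pi_rat \<longleftrightarrow> (\<exists>n>0. cheb w n = 2)"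
proof
  assume "w \<in> two_cos_pi_rat"
  then obtain u n where "w = u + inverse u" "n > 0" "u ^ n = 1"
    by (auto simp: two_cos_pi_rat_iff root_of_unity_def)
  then show "\<exists>n>0. cheb w n = 2"
    by (intro exI[of _ n], cases "u = 0") (auto simp: cheb_add_inverse power_inverse power_0_left)
next
  assume "\<exists>n>0. cheb w n = 2"
  then obtain n where n: "n > 0" "cheb w n = 2" by blast
  obtain u where u: "u \<noteq> 0" "w = u + inverse u" using ex_add_inverse by blast
  have "u ^ n + inverse (u ^ n) = 2"
    using n(2) u(1) unfolding u(2) by (simp add: cheb_add_inverse power_inverse)
  then have "u ^ n * (u ^ n) + u ^ n * inverse (u ^ n) = 2 * u ^ n"
    by (simp only: flip: distrib_left mult.commute[of "u ^ n" 2])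
  then have "(u ^ n - 1) ^ 2 = 0"
    using u(1) by (simp add: power2_eq_square algebra_simps)
  then have "root_of_unity u"
    using n(1) by (intro root_of_unityI) auto
  then show "w \<in> two_cos_pi_rat"
    using u(2) unfolding two_cos_pi_rat_iff by blast
qed

lemma norm_two_cos_pi_rat: "w \<in> two_cos_pi_rat \<Longrightarrow> norm w \<le> 2"
  by (auto simp: two_cos_pi_rat_def)

text \<open>
  Membership in \<^const>\<open>two_cos_pi_rat\<close> is an integral polynomial condition, so it is inherited by
  all conjugates. An integral annihilating polynomial \<open>m\<close> of least degree replaces the minimal
  polynomial; pseudo-division by it costs only powers of its leading coefficient.
\<close>

lemma finite_two_cos_in_adjoin_int:
  assumes N: "N > 0" "\<zeta> ^ N = 1"
  shows "finite (adjoin_int \<zeta> \<inter> two_cos_pi_rat)"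
proof -
  define f where "f = monom 1 N - (1 :: int poly)"
  have f_eval: "int_eval f c = c ^ N - 1" for c by (simp add: f_def)
  have f: "f \<noteq> 0" "Polynomial.degree f = N" "lead_coeff f = 1"
  proof -
    show deg: "Polynomial.degree f = N"
      unfolding f_def diff_conv_add_uminus using N(1)
      by (subst degree_add_eq_left) (auto simp: degree_monom_eq)
    then show "lead_coeff f = 1" using N(1) by (simp add: f_def)
    then show "f \<noteq> 0" by auto
  qed
  obtain m where m: "m \<noteq> 0" "int_eval m \<zeta> = 0"
    and m_min: "\<And>p. p \<noteq> 0 \<Longrightarrow> int_eval p \<zeta> = 0 \<Longrightarrow> Polynomial.degree m \<le> Polynomial.degree p"
    using ex_has_least_nat[of "\<lambda>p. p \<noteq> 0 \<and> int_eval p \<zeta> = 0" f Polynomial.degree] f(1) N(2) f_eval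
    by auto
  have div: "\<exists>a q. a \<noteq> 0 \<and> Polynomial.smult a p = m * q" if p: "int_eval p \<zeta> = 0" for p
  proof -
    obtain a q where aq: "a \<noteq> 0" "Polynomial.smult a p = m * q + pseudo_mod p m"
      using pseudo_mod(1)[OF m(1), of p] by auto
    have "int_eval (pseudo_mod p m) \<zeta> = 0"
      using arg_cong[OF aq(2), of "\<lambda>p. int_eval p \<zeta>"] p m(2) by simp
    then have "pseudo_mod p m = 0"
      using m_min[of "pseudo_mod p m"] pseudo_mod(2)[OF m(1), of p] by fastforce
    then show ?thesis using aq by auto
  qed
  define M where "M = (map_poly of_int m :: complex poly)"
  have M: "M \<noteq> 0" "Polynomial.degree M = Polynomial.degree m" "poly M c = int_eval m c" for c
    using m(1) by (simp_all add: M_def int_eval_def)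
  define V where "V = {c. poly M c = 0}"
  have "finite V" using M(1) by (simp add: V_def poly_roots_finite)
  \<comment> \<open>The elements of \<open>V\<close> are the conjugates of \<open>\<zeta>\<close>:
    they satisfy every integral relation that \<open>\<zeta>\<close> satisfies.\<close>
  have V: "int_eval p c = 0" if "int_eval p \<zeta> = 0" "c \<in> V" for p c
  proof -
    obtain a q where "a \<noteq> 0" and aq: "Polynomial.smult a p = m * q"
      using div \<open>int_eval p \<zeta> = 0\<close> by blast
    have "int_eval m c = 0" using that(2) M(3)[of c] by (simp add: V_def)
    then have "of_int a * int_eval p c = 0"
      using arg_cong[OF aq, of "\<lambda>p. int_eval p c"] by simp
    then show ?thesis using \<open>a \<noteq> 0\<close> by simp
  qed
  \<comment> \<open>Up to a nonzero scalar, \<open>M\<close> divides \<open>X ^ N - 1\<close>, which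
    has no repeated root. Hence \<open>card V\<close> is the degree of \<open>m\<close>, and
    remainders modulo \<open>m\<close> are determined by their values on \<open>V\<close>.\<close>
  have "rsquarefree M"
    unfolding rsquarefree_roots
  proof (intro allI notI)
    fix c assume c: "poly M c = 0 \<and> poly (pderiv M) c = 0"
    obtain a q where aq: "a \<noteq> 0" "Polynomial.smult a f = m * q"
      using div[of f] N(2) f_eval by auto
    have "Polynomial.smult (of_int a) (monom 1 N - 1) = M * map_poly of_int q"
      using arg_cong[OF aq(2), of "map_poly complex_of_int"]
      by (simp add: M_def f_def hom_distribs)
    from arg_cong[OF this, of "\<lambda>p. poly (pderiv p) c"]
    have "of_int a * (of_nat N * c ^ (N - 1)) = 0"
      using c by (simp add: pderiv_smult pderiv_diff pderiv_monom poly_monom pderiv_mult)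
    moreover have "c ^ N = 1"
      using V[of f c] c N(2) f_eval by (simp add: V_def)
    then have "c \<noteq> 0" using N(1) by (auto simp: power_0_left)
    ultimately show False using aq(1) N(1) by simp
  qed
  then have "Polynomial.smult (lead_coeff M) (\<Prod>c\<in>V. [:- c, 1:]) = M"
    unfolding V_def by (rule complex_poly_decompose_rsquarefree)
  then have "Polynomial.degree (\<Prod>c\<in>V. [:- c, 1:]) = Polynomial.degree M"
    using M(1) by (metis degree_smult_eq leading_coeff_0_iff)
  then have cardV: "card V = Polynomial.degree m"
    using M(2) by (subst (asm) degree_prod_eq_sum_degree) auto
  have "card V > 0"
    using m(2) \<open>finite V\<close> M(3) by (auto simp: card_gt_0_iff V_def)
  define L where "L = lead_coeff m"
  have L: "L \<noteq> 0" using m(1) by (simp add: L_def)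
  define R where "R k = {p. Polynomial.degree p < card V \<and>
    (\<forall>c\<in>V. norm (int_eval p c) \<le> norm (of_int L :: complex) ^ k * 2)}" for k :: nat
  have "adjoin_int \<zeta> \<inter> two_cos_pi_rat \<subseteq> (\<Union>k\<le>N. (\<lambda>p. int_eval p \<zeta> / of_int L ^ k) ` R k)"
  proof
    fix w assume w: "w \<in> adjoin_int \<zeta> \<inter> two_cos_pi_rat"
    then obtain p0 where p0: "w = int_eval p0 \<zeta>" by (auto simp: adjoin_int_def)
    \<comment> \<open>Reducing modulo the monic \<open>f\<close> first bounds the degree of the
      representative by \<open>N\<close>. This limits the exponent \<open>k\<close> of the leading
      coefficient in the second division, so finitely many sets \<open>R k\<close> suffice.\<close>
    obtain q1 p where q1: "pseudo_divmod p0 f = (q1, p)" by fastforce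
    have p0_eq: "p0 = f * q1 + p" and p_deg: "Polynomial.degree p < N"
      using pseudo_divmod[OF f(1) q1] f N(1) by auto
    have wp: "w = int_eval p \<zeta>"
      using p0 f_eval N(2) by (simp add: p0_eq)
    obtain n where n: "n > 0" "cheb w n = 2"
      using w two_cos_pi_rat_cheb by auto
    have p_bound: "norm (int_eval p c) \<le> 2" if "c \<in> V" for c
    proof -
      have two: "int_eval 2 c = 2" for c
        using int_eval_simps(3)[of 1 1 c] by simp
      have "int_eval (cheb p n - 2) \<zeta> = 0"
        using n by (simp add: int_eval_cheb wp two)
      then have "int_eval (cheb p n - 2) c = 0"
        by (rule V[OF _ that])
      then have "cheb (int_eval p c) n = 2"
        by (simp add: int_eval_cheb two)
      then show ?thesis
        using n norm_two_cos_pi_rat two_cos_pi_rat_cheb by blast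
    qed
    obtain q r where qr: "pseudo_divmod p m = (q, r)" by fastforce
    define k where "k = Suc (Polynomial.degree p) - Polynomial.degree m"
    have r_eq: "Polynomial.smult (L ^ k) p = m * q + r" and r_deg: "Polynomial.degree r < card V"
      using pseudo_divmod[OF m(1) qr] \<open>card V > 0\<close> by (auto simp: L_def k_def cardV)
    have r_eval: "int_eval r c = of_int L ^ k * int_eval p c" if "int_eval m c = 0" for c
      using arg_cong[OF r_eq, of "\<lambda>p. int_eval p c"] that by simp
    have "r \<in> R k"
      using r_deg r_eval p_bound M(3)
      by (auto simp: R_def V_def norm_mult norm_power intro!: mult_left_mono)
    moreover have "w = int_eval r \<zeta> / of_int L ^ k"
      using r_eval[OF m(2)] L wp by simp
    moreover have "k \<le> N" using p_deg by (simp add: k_def)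
    ultimately show "w \<in> (\<Union>k\<le>N. (\<lambda>p. int_eval p \<zeta> / of_int L ^ k) ` R k)" by blast
  qed
  moreover have "finite (R k)" for k
    unfolding R_def by (rule finite_bounded_int_polys) fact
  ultimately show ?thesis
    by (meson finite_UN_I finite_atMost finite_imageI finite_subset)
qed

text \<open>Multiplication by \<open>w\<close> acts on the powers \<open>\<zeta> ^ i\<close> with
  \<open>i < N\<close> by an integer matrix, so \<open>w\<close> is a root of its monic
  characteristic polynomial.\<close>

lemma algebraic_int_adjoin_int:
  assumes N: "N > 0" "\<zeta> ^ N = 1" and w: "w \<in> adjoin_int \<zeta>"
  shows "algebraic_int w"
proof -
  obtain p where p: "w = int_eval p \<zeta>" using w by (auto simp: adjoin_int_def)
  \<comment> \<open>Row \<open>i\<close> lists the coefficients of \<open>X ^ i * p\<close> after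
    the exponents are reduced modulo \<open>N\<close>.\<close>
  define A where "A = mat N N (\<lambda>(i, j).
    \<Sum>k\<in>{k. k \<le> Polynomial.degree p \<and> (i + k) mod N = j}. Polynomial.coeff p k)"
  define B where "B = map_mat complex_of_int A"
  define v where "v = vec N (\<lambda>i. \<zeta> ^ i)"
  have A: "A \<in> carrier_mat N N" and B: "B \<in> carrier_mat N N"
    by (simp_all add: A_def B_def)
  have mod: "\<zeta> ^ (n mod N) = \<zeta> ^ n" for n
  proof -
    have "\<zeta> ^ n = \<zeta> ^ (N * (n div N) + n mod N)" by simp
    also have "\<dots> = \<zeta> ^ (n mod N)" by (simp only: power_add power_mult N(2)) simp
    finally show ?thesis by simp
  qed
  have "B *\<^sub>v v = w \<cdot>\<^sub>v v"
  proof (rule eq_vecI)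
    fix i assume "i < dim_vec (w \<cdot>\<^sub>v v)"
    then have i: "i < N" by (simp add: v_def)
    have "(B *\<^sub>v v) $ i = (\<Sum>j<N. \<Sum>k\<in>{k \<in> {..Polynomial.degree p}. (i + k) mod N = j}.
        of_int (Polynomial.coeff p k) * \<zeta> ^ j)"
      using i by (simp add: B_def A_def v_def scalar_prod_def sum_distrib_right atLeast0LessThan)
    also have "\<dots> = (\<Sum>j<N. \<Sum>k\<in>{k \<in> {..Polynomial.degree p}. (i + k) mod N = j}.
        of_int (Polynomial.coeff p k) * \<zeta> ^ (i + k))"
      by (intro sum.cong refl) (auto simp: mod)
    also have "\<dots> = (\<Sum>k\<le>Polynomial.degree p. of_int (Polynomial.coeff p k) * \<zeta> ^ (i + k))"
      using N(1) by (intro sum.group) auto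
    also have "\<dots> = w * \<zeta> ^ i"
      by (simp add: p int_eval_sum sum_distrib_left power_add mult_ac)
    finally show "(B *\<^sub>v v) $ i = (w \<cdot>\<^sub>v v) $ i"
      using i by (simp add: v_def)
  qed (simp add: B_def A_def v_def)
  moreover have "v \<noteq> 0\<^sub>v N"
  proof
    assume "v = 0\<^sub>v N"
    then have "v $ 0 = 0" using N(1) by simp
    then show False using N(1) by (simp add: v_def)
  qed
  ultimately have "eigenvalue B w"
    unfolding eigenvalue_def eigenvector_def using B by (intro exI[of _ v]) (simp add: v_def)
  then have "poly (char_poly B) w = 0"
    using eigenvalue_root_char_poly[OF B] by simp
  then have "poly (map_poly of_int (char_poly A)) w = 0"
    unfolding B_def of_int_hom.char_poly_hom[OF A] .
  then show ?thesis
    unfolding algebraic_int_altdef_ipoly using degree_monic_char_poly[OF A] by auto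
qed

lemma adjoin_int_subset_cyclotomic_field:
  "adjoin_int (cis (2 * pi / real n)) \<subseteq> cyclotomic_field n"
proof -
  have "int_eval p (cis (2 * pi / real n)) \<in> cyclotomic_field n" for p
  proof (induction p)
    case 0
    then show ?case using cyclotomic_field_closed(2)[of 0] by simp
  next
    case (pCons a p)
    then show ?case
      by (simp only: int_eval_simps cyclotomic_field_closed)
  qed
  then show ?thesis by (auto simp: adjoin_int_def)
qed

text \<open>The claim covers all multiples of \<open>n\<close>, so that finitely many elements fit
  into one ring by multiplying their orders.\<close>

lemma two_cos_pi_rat_in_adjoin_int:
  assumes "w \<in> two_cos_pi_rat"
  obtains n where "n > 0"
    "\<And>N. N > 0 \<Longrightarrow> n dvd N \<Longrightarrow> w \<in> adjoin_int (cis (2 * pi / real N))"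
proof -
  obtain u n where u: "w = u + inverse u" "n > 0" "u ^ n = 1"
    using assms by (auto simp: two_cos_pi_rat_iff root_of_unity_def)
  show ?thesis
  proof (rule that)
    fix N :: nat assume N: "N > 0" "n dvd N"
    have uN: "u ^ N = 1" using N(2) u(3) by (auto simp: power_mult elim!: dvdE)
    then obtain k where k: "u = cis (2 * pi * real k / real N)"
      using bij_betw_roots_unity[OF N(1)] by (auto simp: bij_betw_def)
    then have "u = cis (2 * pi / real N) ^ k"
      by (simp add: DeMoivre mult_ac)
    moreover have "u * u ^ (N - 1) = 1"
      using uN N(1) by (simp flip: power_Suc)
    then have "inverse u = u ^ (N - 1)" by (rule inverse_unique)
    ultimately have "w = cis (2 * pi / real N) ^ k + cis (2 * pi / real N) ^ (k * (N - 1))"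
      using u(1) by (simp add: power_mult)
    then show "w \<in> adjoin_int (cis (2 * pi / real N))"
      by (simp add: adjoin_int_arith power_in_adjoin_int)
  qed (rule u(2))
qed

lemma finite_two_cos_pi_rat_in_adjoin_int:
  assumes "finite G" "G \<subseteq> two_cos_pi_rat"
  obtains N where "N > 0" "G \<subseteq> adjoin_int (cis (2 * pi / real N))"
proof -
  have "\<exists>n>0. \<forall>N>0. n dvd N \<longrightarrow> G \<subseteq> adjoin_int (cis (2 * pi / real N))"
    using assms
  proof (induction G rule: finite_induct)
    case (insert w G)
    then obtain n where n: "n > 0" "\<And>N. N > 0 \<Longrightarrow> n dvd N \<Longrightarrow> G \<subseteq> adjoin_int (cis (2 * pi / real N))"
      by blast
    obtain n' where n': "n' > 0" "\<And>N. N > 0 \<Longrightarrow> n' dvd N \<Longrightarrow> w \<in> adjoin_int (cis (2 * pi / real N))"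
      using insert.prems two_cos_pi_rat_in_adjoin_int[of w] by blast
    have "insert w G \<subseteq> adjoin_int (cis (2 * pi / real N))" if "N > 0" "n * n' dvd N" for N
      using n(2)[OF that(1) dvd_mult_left[OF that(2)]] n'(2)[OF that(1) dvd_mult_right[OF that(2)]]
      by simp
    then show ?case
      using n(1) n'(1) by (intro exI[of _ "n * n'"]) simp
  qed auto
  then obtain n where "n > 0" "\<forall>N>0. n dvd N \<longrightarrow> G \<subseteq> adjoin_int (cis (2 * pi / real N))"
    by (elim exE conjE)
  then show ?thesis using that[of n] by simp
qed

section \<open>Arithmetic of even orbits\<close>

context flip_system
begin

lemma coordinates_in_adjoin_int:
  assumes m: "m \<in> S"
    and good: "\<And>p. p \<in> even_orbit m \<Longrightarrow>
      x p \<in> two_cos_pi_rat \<and> y p \<in> two_cos_pi_rat \<and> z p \<in> two_cos_pi_rat"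
  obtains N where "N > 0" "{\<theta>1, \<theta>2, \<theta>3, \<theta>4, x m, y m, z m} \<subseteq> adjoin_int (cis (2 * pi / real N))"
proof -
  have sub: "{x m, y m, z m, x (s1 m), y (s2 m), z (s3 m)} \<subseteq> two_cos_pi_rat"
    using good[OF self_in_even_orbit] flip_coordinates_good[OF m self_in_even_orbit good] by simp
  have fin: "finite {x m, y m, z m, x (s1 m), y (s2 m), z (s3 m)}" by simp
  obtain N where N: "N > 0"
    "{x m, y m, z m, x (s1 m), y (s2 m), z (s3 m)} \<subseteq> adjoin_int (cis (2 * pi / real N))"
    by (rule finite_two_cos_pi_rat_in_adjoin_int[OF fin sub])
  let ?A = "adjoin_int (cis (2 * pi / real N))"
  note arith = adjoin_int_arith[where w = "cis (2 * pi / real N)"]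
  have eq: "\<theta>1 = x (s1 m) + x m + y m * z m" "\<theta>2 = y (s2 m) + y m + z m * x m"
    "\<theta>3 = z (s3 m) + z m + x m * y m"
    using m by (simp_all add: s1 s2 s3)
  have "\<theta>4 = x m * x (s1 m) + y m * y (s2 m) + z m * z (s3 m) + (x m * y m * z m + x m * y m * z m)"
    using \<theta>4_eq[OF m] by simp
  then have "\<theta>4 \<in> ?A"
    using N(2) by (simp only: insert_subset arith)
  moreover have "\<theta>1 \<in> ?A" "\<theta>2 \<in> ?A" "\<theta>3 \<in> ?A"
    using N(2) unfolding eq by (simp_all only: insert_subset arith)
  ultimately show ?thesis
    using N by (intro that[of N]) auto
qed

text \<open>The ring that contains the parameters and the coordinates of \<open>m\<close> is
  preserved by the flip formulas, so the whole orbit has coordinates in its finite intersection with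
  \<open>two_cos_pi_rat\<close>.\<close>

lemma finite_even_orbit_if_good:
  assumes m: "m \<in> S"
    and good: "\<And>p. p \<in> even_orbit m \<Longrightarrow>
      x p \<in> two_cos_pi_rat \<and> y p \<in> two_cos_pi_rat \<and> z p \<in> two_cos_pi_rat"
  shows "finite (even_orbit m)"
proof -
  obtain N where N: "N > 0"
    "{\<theta>1, \<theta>2, \<theta>3, \<theta>4, x m, y m, z m} \<subseteq> adjoin_int (cis (2 * pi / real N))"
    by (rule coordinates_in_adjoin_int[OF m good])
  let ?R = "adjoin_int (cis (2 * pi / real N))"
  note arith = adjoin_int_arith[where w = "cis (2 * pi / real N)"]
  define A where "A = {n \<in> S. x n \<in> ?R \<and> y n \<in> ?R \<and> z n \<in> ?R}"
  have "even_orbit m \<subseteq> A"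
    by (rule even_orbit_subset_closed)
      (use N(2) m in \<open>auto simp: A_def s1 s2 s3 closed arith\<close>)
  moreover have "finite (?R \<inter> two_cos_pi_rat)"
    using N(1) by (intro finite_two_cos_in_adjoin_int[of N]) (simp_all add: DeMoivre)
  then have "finite ((?R \<inter> two_cos_pi_rat) \<times> (?R \<inter> two_cos_pi_rat) \<times> (?R \<inter> two_cos_pi_rat))"
    by (intro finite_cartesian_product)
  moreover have "inj_on (\<lambda>n. (x n, y n, z n)) (even_orbit m)"
    using even_orbit_subset[OF m] by (intro inj_onI) (auto intro: ext)
  moreover have "(\<lambda>n. (x n, y n, z n)) ` even_orbit m \<subseteq>
      (?R \<inter> two_cos_pi_rat) \<times> (?R \<inter> two_cos_pi_rat) \<times> (?R \<inter> two_cos_pi_rat)"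
    using \<open>even_orbit m \<subseteq> A\<close> good by (auto simp: A_def)
  ultimately show ?thesis
    by (meson inj_on_finite)
qed

lemma parameters_real_cyclotomic:
  assumes m: "m \<in> S"
    and good: "\<And>p. p \<in> even_orbit m \<Longrightarrow>
      x p \<in> two_cos_pi_rat \<and> y p \<in> two_cos_pi_rat \<and> z p \<in> two_cos_pi_rat"
    and t: "t \<in> {\<theta>1, \<theta>2, \<theta>3, \<theta>4}"
  shows "real_cyclotomic_integer t"
proof -
  obtain N where N: "N > 0"
    "{\<theta>1, \<theta>2, \<theta>3, \<theta>4, x m, y m, z m} \<subseteq> adjoin_int (cis (2 * pi / real N))"
    by (rule coordinates_in_adjoin_int[OF m good])
  have "w \<in> \<real>" if "w \<in> two_cos_pi_rat" for w
    using that by (auto simp: two_cos_pi_rat_def)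
  then have real: "x m \<in> \<real>" "y m \<in> \<real>" "z m \<in> \<real>" "x (s1 m) \<in> \<real>" "y (s2 m) \<in> \<real>" "z (s3 m) \<in> \<real>"
    using good[OF self_in_even_orbit] flip_coordinates_good[OF m self_in_even_orbit good] by blast+
  have "\<theta>1 = x (s1 m) + x m + y m * z m" "\<theta>2 = y (s2 m) + y m + z m * x m"
    "\<theta>3 = z (s3 m) + z m + x m * y m"
    using m by (simp_all add: s1 s2 s3)
  then have "\<theta>1 \<in> \<real>" "\<theta>2 \<in> \<real>" "\<theta>3 \<in> \<real>" "\<theta>4 \<in> \<real>"
    using real \<theta>4_eq[OF m] by (simp_all only: Reals_add Reals_mult Reals_numeral)
  moreover have "t \<in> adjoin_int (cis (2 * pi / real N))" using N(2) t by auto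
  then have "t \<in> cyclotomic_field N" "algebraic_int t"
    using adjoin_int_subset_cyclotomic_field[of N] N(1)
      algebraic_int_adjoin_int[OF N(1), of "cis (2 * pi / real N)" t] by (simp_all add: DeMoivre subset_iff)
  moreover have "N \<ge> 1" using N(1) by simp
  ultimately show ?thesis
    using t unfolding real_cyclotomic_integer_def by blast
qed

lemma even_orbit_finite_iff:
  assumes m: "m \<in> S" and degree: "infinite (even_orbit m) \<or> card (even_orbit m) \<ge> 5"
  defines "good \<equiv> \<forall>p \<in> even_orbit m. x p \<in> two_cos_pi_rat \<and> y p \<in> two_cos_pi_rat \<and> z p \<in> two_cos_pi_rat"
  shows "finite (even_orbit m) \<longleftrightarrow> good"
    and "finite (even_orbit m) \<Longrightarrow> t \<in> {\<theta>1, \<theta>2, \<theta>3, \<theta>4} \<Longrightarrow> real_cyclotomic_integer t"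
    and "finite (even_orbit m) \<Longrightarrow> t \<in> {\<theta>1, \<theta>2, \<theta>3} \<Longrightarrow> - 8 < Re t \<and> Re t < 8"
    and "finite (even_orbit m) \<Longrightarrow> - 28 < Re \<theta>4 \<and> Re \<theta>4 < 28"
proof -
  interpret r: flip_system S s2 s3 s1 y z x \<theta>2 \<theta>3 \<theta>1 \<theta>4
    by (rule flip_system_rotate)
  interpret rr: flip_system S s3 s1 s2 z x y \<theta>3 \<theta>1 \<theta>2 \<theta>4
    by (rule r.flip_system_rotate)
  have orb: "r.even_orbit = even_orbit" "rr.even_orbit = even_orbit"
    by (simp_all add: even_orbit_def r.even_orbit_def rr.even_orbit_def fun_eq_iff insert_commute)
  have fin_good: good if "finite (even_orbit m)"
    using finite_even_orbit_good[OF m that] degree that by (auto simp: good_def)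
  moreover have "finite (even_orbit m)" if good
    using finite_even_orbit_if_good[OF m] that by (auto simp: good_def)
  ultimately show "finite (even_orbit m) \<longleftrightarrow> good" by blast
  assume fin: "finite (even_orbit m)"
  then have card: "card (even_orbit m) \<ge> 5" using degree by blast
  note g = fin_good[OF fin, unfolded good_def]
  show "real_cyclotomic_integer t" if "t \<in> {\<theta>1, \<theta>2, \<theta>3, \<theta>4}"
    by (rule parameters_real_cyclotomic[OF m _ that]) (rule g[rule_format])
  show "- 28 < Re \<theta>4 \<and> Re \<theta>4 < 28"
    by (intro conjI \<theta>4_bounds[OF m card] g[rule_format])
  have "- 8 < Re \<theta>1 \<and> Re \<theta>1 < 8"
    by (intro conjI \<theta>1_bounds[OF m card] g[rule_format])
  moreover have "- 8 < Re \<theta>2 \<and> Re \<theta>2 < 8"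
    using r.\<theta>1_bounds[OF m, unfolded orb, OF card] g by simp
  moreover have "- 8 < Re \<theta>3 \<and> Re \<theta>3 < 8"
    using rr.\<theta>1_bounds[OF m, unfolded orb, OF card] g by simp
  ultimately show "- 8 < Re t \<and> Re t < 8" if "t \<in> {\<theta>1, \<theta>2, \<theta>3}"
    using that by auto
qed

end

section \<open>Transfer to the cubic surface\<close>

lemma flip_system_cubic_surface:
  "flip_system (cubic_surface (\<theta>1, \<theta>2, \<theta>3, \<theta>4)) (flip1 (\<theta>1, \<theta>2, \<theta>3, \<theta>4))
    (flip2 (\<theta>1, \<theta>2, \<theta>3, \<theta>4)) (flip3 (\<theta>1, \<theta>2, \<theta>3, \<theta>4))
    fst (\<lambda>p. fst (snd p)) (\<lambda>p. snd (snd p)) \<theta>1 \<theta>2 \<theta>3 \<theta>4"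
proof -
  define \<theta> where "\<theta> = (\<theta>1, \<theta>2, \<theta>3, \<theta>4)"
  have surface: "fst m * fst (snd m) * snd (snd m) + fst m ^ 2 + fst (snd m) ^ 2 + snd (snd m) ^ 2
      - \<theta>1 * fst m - \<theta>2 * fst (snd m) - \<theta>3 * snd (snd m) + \<theta>4 = 0"
    if "m \<in> cubic_surface \<theta>" for m
    using that by (cases m) (simp add: \<theta>_def)
  have flips: "flip1 \<theta> m = (\<theta>1 - fst m - fst (snd m) * snd (snd m), fst (snd m), snd (snd m))"
    "flip2 \<theta> m = (fst m, \<theta>2 - fst (snd m) - snd (snd m) * fst m, snd (snd m))"
    "flip3 \<theta> m = (fst m, fst (snd m), \<theta>3 - snd (snd m) - fst m * fst (snd m))"
    if "m \<in> cubic_surface \<theta>" for m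
    using that by (cases m; simp add: \<theta>_def mult.commute)+
  have closed: "flip1 \<theta> m \<in> cubic_surface \<theta>" "flip2 \<theta> m \<in> cubic_surface \<theta>"
    "flip3 \<theta> m \<in> cubic_surface \<theta>" if "m \<in> cubic_surface \<theta>" for m
    using flip_closed(1)[OF _ that] by (simp_all add: flips_def)
  show ?thesis
    unfolding \<theta>_def[symmetric]
  proof (rule flip_system.intro)
    show "m = m'" if "fst m = fst m'" "fst (snd m) = fst (snd m')" "snd (snd m) = snd (snd m')"
      for m m' :: point
      using that by (simp add: prod_eq_iff)
  qed ((rule closed surface, assumption) | simp add: flips)+
qed

text \<open>\<open>BijGroup\<close> multiplies by restricted composition, which agrees with ordinary
  composition at points of the surface. This identifies the orbits of \<open>flip_group2\<close>
  with even orbits.\<close>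

lemma word_product_apply:
  assumes "set ws \<subseteq> flips \<theta>" "m \<in> cubic_surface \<theta>"
  shows "foldr (monoid.mult (flip_group \<theta>)) ws \<one>\<^bsub>flip_group \<theta>\<^esub> m = foldr (\<lambda>f. f) ws m"
proof -
  let ?B = "BijGroup (cubic_surface \<theta>)"
  have mult: "monoid.mult (flip_group \<theta>) = monoid.mult ?B" "\<one>\<^bsub>flip_group \<theta>\<^esub> = \<one>\<^bsub>?B\<^esub>"
    by (simp_all add: flip_group_def)
  have carr: "carrier ?B = Bij (cubic_surface \<theta>)" by (simp add: BijGroup_def)
  have mult_apply: "monoid.mult ?B f g n = f (g n)"
    if "f \<in> Bij (cubic_surface \<theta>)" "g \<in> Bij (cubic_surface \<theta>)" "n \<in> cubic_surface \<theta>" for f g n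
    using that by (simp add: BijGroup_def compose_def)
  show ?thesis
    unfolding mult using assms(1)
  proof (induction ws)
    case Nil
    then show ?case using assms(2) by (simp add: BijGroup_def)
  next
    case (Cons w ws)
    have ws: "set ws \<subseteq> carrier ?B" and w: "w \<in> Bij (cubic_surface \<theta>)"
      unfolding carr using subset_trans[OF Cons.prems flips_subset_Bij[of \<theta>]] by simp_all
    let ?F = "foldr (monoid.mult ?B) ws \<one>\<^bsub>?B\<^esub>"
    have "?F \<in> carrier ?B"
      by (rule group.foldr_mult_closed[OF group_BijGroup ws])
    then have "monoid.mult ?B w ?F m = w (?F m)"
      using mult_apply w assms(2) unfolding carr by blast
    moreover have "?F m = foldr (\<lambda>f. f) ws m"
      using Cons.IH Cons.prems by simp
    ultimately show ?case by simp
  qed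
qed

theorem theorem10:
  fixes \<theta>1 \<theta>2 \<theta>3 \<theta>4 :: complex
    and \<O> :: "(complex \<times> complex \<times> complex) set"
  assumes orbit: "\<O> \<in> orbits (flip_group2 (\<theta>1, \<theta>2, \<theta>3, \<theta>4)) (cubic_surface (\<theta>1, \<theta>2, \<theta>3, \<theta>4)) (\<lambda>g. g)"
    and degree: "infinite \<O> \<or> card \<O> \<ge> 7"
  shows "(finite \<O> \<longleftrightarrow>
            \<O> \<subseteq> cubic_surface (\<theta>1, \<theta>2, \<theta>3, \<theta>4) \<inter> two_cos_pi_rat \<times> two_cos_pi_rat \<times> two_cos_pi_rat) \<and>
         (finite \<O> \<longrightarrow>
            (\<forall>t \<in> {\<theta>1, \<theta>2, \<theta>3, \<theta>4}. real_cyclotomic_integer t) \<and>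
            (\<forall>t \<in> {\<theta>1, \<theta>2, \<theta>3}. -8 < Re t \<and> Re t < 8) \<and>
            -28 < Re \<theta>4 \<and> Re \<theta>4 < 28)"
proof -
  define \<theta> where "\<theta> = (\<theta>1, \<theta>2, \<theta>3, \<theta>4)"
  interpret flip_system "cubic_surface \<theta>" "flip1 \<theta>" "flip2 \<theta>" "flip3 \<theta>"
    fst "\<lambda>p. fst (snd p)" "\<lambda>p. snd (snd p)" \<theta>1 \<theta>2 \<theta>3 \<theta>4
    unfolding \<theta>_def by (rule flip_system_cubic_surface)
  obtain m where m: "m \<in> cubic_surface \<theta>" and orb: "\<O> = orbit (flip_group2 \<theta>) (\<lambda>g. g) m"
    using orbit unfolding orbits_def \<theta>_def by blast
  have "\<O> = (\<lambda>ws. foldr (monoid.mult (flip_group \<theta>)) ws \<one>\<^bsub>flip_group \<theta>\<^esub> m)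
      ` {ws. set ws \<subseteq> flips \<theta> \<and> even (length ws)}"
    unfolding orb orbit_def flip_group2_def by auto
  also have "\<dots> = (\<lambda>ws. foldr (\<lambda>f. f) ws m) ` {ws. set ws \<subseteq> flips \<theta> \<and> even (length ws)}"
    using word_product_apply[OF _ m] by (intro image_cong) auto
  also have "\<dots> = even_orbit m"
    unfolding even_orbit_def flips_def by auto
  finally have orb: "\<O> = even_orbit m" .
  then have "\<O> \<subseteq> cubic_surface \<theta>"
    using even_orbit_subset[OF m] by simp
  then have coords: "\<O> \<subseteq> cubic_surface \<theta> \<inter> two_cos_pi_rat \<times> two_cos_pi_rat \<times> two_cos_pi_rat \<longleftrightarrow>
      (\<forall>p\<in>\<O>. fst p \<in> two_cos_pi_rat \<and> fst (snd p) \<in> two_cos_pi_rat \<and> snd (snd p) \<in> two_cos_pi_rat)"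
    unfolding subset_iff Int_iff mem_Times_iff Ball_def by blast
  have "infinite (even_orbit m) \<or> card (even_orbit m) \<ge> 5"
    using degree unfolding orb by linarith
  note result = even_orbit_finite_iff[OF m this, folded orb]
  show ?thesis
    unfolding \<theta>_def[symmetric] coords using result by blast
qed

end
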